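(* Let $k$ be a field, $d\ge2$ an integer, and let $\Delta^-\subseteq\Delta\subseteq\Delta^+$ be simplicial complexes on the same vertex set $V=\{x_1,\dots,x_n\}$, where $\Delta^-$ and $\Delta^+$ have dimension $d-1$. If both $k[\Delta^-]$ and $k[\Delta^+]$ are Buchsbaum Stanley--Reisner rings with $d$-linear resolutions, then $k[\Delta]$ is also a Buchsbaum Stanley--Reisner ring with $d$-linear resolution.
   Context: A simplicial complex $\Delta$ on $V=\{x_1,\dots,x_n\}$ is a collection of subsets of $V$ closed under taking subsets and containing every singleton $\{x_i\}$. $S=k[x_1,\dots,x_n]$ (standard grading), $I_\Delta$ is generated by the square-free monomials $x_{i_1}\cdots x_{i_r}$ with $\{x_{i_1},\dots,x_{i_r}\}\notin\Delta$, and $k[\Delta]=S/I_\Delta$ is the Stanley--Reisner ring, of Krull dimension $\dim\Delta+1$. $k[\Delta]$ is Buchsbaum if $\Delta$ is pure and $\widetilde H_i(\operatorname{link}_\Delta F;k)=0$ for every nonempty face $F$ and every $i<\dim\operatorname{link}_\Delta F$. For $A=S/I$, $\beta_{i,j}(A)=\dim_k\operatorname{Tor}_i^S(A,k)_j$, $\operatorname{reg}A=\max\{j-i:\beta_{i,j}(A)\ne0\}$ and $\operatorname{indeg}A=\min\{j: I_j\neq0\}$. $A$ has $d$-linear resolution if $\operatorname{reg}A=\operatorname{indeg}A-1=d-1$. *)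

theory Defs
  imports
    "HOL-Library.Poly_Mapping"
    "HOL-Library.Function_Algebras"
    "HOL-Library.Extended_Nat"
begin

section \<open>Simplicial complexes\<close>

text \<open>The vertices \<open>x\<^sub>1, \<dots>, x\<^sub>n\<close> are the elements of a finite linearly
  ordered type; the order corresponds to the numbering and only enters through signs.\<close>

definition simplicial_complex :: "'v set set \<Rightarrow> bool" where
  "simplicial_complex \<Delta> \<longleftrightarrow>
     (\<forall>F\<in>\<Delta>. \<forall>G. G \<subseteq> F \<longrightarrow> G \<in> \<Delta>) \<and> (\<forall>v. {v} \<in> \<Delta>)"

definition complex_dim :: "'v::finite set set \<Rightarrow> int" where
  "complex_dim \<Delta> = Max ((\<lambda>F. int (card F) - 1) ` \<Delta>)"

definition facets :: "'v set set \<Rightarrow> 'v set set" where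
  "facets \<Delta> = {F \<in> \<Delta>. \<forall>G\<in>\<Delta>. F \<subseteq> G \<longrightarrow> F = G}"

definition pure :: "'v set set \<Rightarrow> bool" where
  "pure \<Delta> \<longleftrightarrow> (\<forall>F\<in>facets \<Delta>. \<forall>G\<in>facets \<Delta>. card F = card G)"

definition link :: "'v set set \<Rightarrow> 'v set \<Rightarrow> 'v set set" where
  "link \<Delta> F = {G \<in> \<Delta>. F \<inter> G = {} \<and> F \<union> G \<in> \<Delta>}"

text \<open>\<open>(-1)\<^sup>p\<close>, where \<open>p\<close> is the position (from 0) of \<open>v\<close> in the increasing
  enumeration of \<open>insert v T\<close>, for \<open>v \<notin> T\<close>.\<close>

definition incidence_sign :: "'v::{finite,linorder} \<Rightarrow> 'v set \<Rightarrow> 'r::comm_ring_1" where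
  "incidence_sign v T = (- 1) ^ card {u \<in> T. u < v}"

text \<open>Oriented augmented chains with coefficients in \<open>'k\<close>; the degree \<open>i\<close> is an
  integer, and the empty face sits in degree \<open>-1\<close>.\<close>

definition chains :: "'v::{finite,linorder} set set \<Rightarrow> int \<Rightarrow> ('v set \<Rightarrow> 'k::field) set" where
  "chains \<Gamma> i = {f. \<forall>F. f F \<noteq> 0 \<longrightarrow> F \<in> \<Gamma> \<and> int (card F) - 1 = i}"

definition simplicial_boundary ::
  "('v::{finite,linorder} set \<Rightarrow> 'k::field) \<Rightarrow> 'v set \<Rightarrow> 'k" where
  "simplicial_boundary f T = (\<Sum>v\<in>- T. incidence_sign v T * f (insert v T))"

definition reduced_homology_vanishes ::
  "'k::field itself \<Rightarrow> 'v::{finite,linorder} set set \<Rightarrow> int \<Rightarrow> bool" where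
  "reduced_homology_vanishes _ \<Gamma> i \<longleftrightarrow>
     {z \<in> chains \<Gamma> i. simplicial_boundary z = (\<lambda>_. 0)}
       = simplicial_boundary ` (chains \<Gamma> (i + 1) :: ('v set \<Rightarrow> 'k) set)"

definition buchsbaum :: "'k::field itself \<Rightarrow> 'v::{finite,linorder} set set \<Rightarrow> bool" where
  "buchsbaum K \<Delta> \<longleftrightarrow> pure \<Delta> \<and>
     (\<forall>F\<in>\<Delta>. F \<noteq> {} \<longrightarrow> (\<forall>i < complex_dim (link \<Delta> F).
        reduced_homology_vanishes K (link \<Delta> F) i))"


section \<open>Polynomial rings and Stanley--Reisner ideals\<close>

type_synonym ('v, 'k) mpoly = "('v \<Rightarrow>\<^sub>0 nat) \<Rightarrow>\<^sub>0 'k"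

definition Const :: "'k::field \<Rightarrow> ('v, 'k) mpoly" where
  "Const a = Poly_Mapping.single 0 a"

definition Var :: "'v \<Rightarrow> ('v, 'k::field) mpoly" where
  "Var v = Poly_Mapping.single (Poly_Mapping.single v 1) 1"

definition monom_deg :: "('v::finite \<Rightarrow>\<^sub>0 nat) \<Rightarrow> nat" where
  "monom_deg t = (\<Sum>v\<in>UNIV. Poly_Mapping.lookup t v)"

definition homogeneous :: "nat \<Rightarrow> ('v::finite, 'k::field) mpoly \<Rightarrow> bool" where
  "homogeneous j p \<longleftrightarrow> (\<forall>t\<in>Poly_Mapping.keys p. monom_deg t = j)"

definition stanley_reisner_ideal :: "'v::finite set set \<Rightarrow> ('v, 'k::field) mpoly set" where
  "stanley_reisner_ideal \<Delta> = module.span (*) ((\<lambda>F. \<Prod>v\<in>F. Var v) ` {F. F \<notin> \<Delta>})"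

text \<open>\<open>indeg (S/I)\<close>, which is \<open>\<infinity>\<close> for \<open>I = 0\<close>.\<close>

definition indeg :: "('v::finite, 'k::field) mpoly set \<Rightarrow> enat" where
  "indeg I = Inf (enat ` {j. \<exists>f\<in>I. f \<noteq> 0 \<and> homogeneous j f})"


section \<open>Tor and graded Betti numbers\<close>

text \<open>A graded free complex \<open>G\<close> of \<open>S\<close>-modules of finite rank is given by homogeneous bases
  \<open>basis i\<close> of \<open>G\<^sub>i\<close>, the degrees \<open>deg\<close> of the basis elements, and the matrices
  \<open>D i\<close> of the differentials from \<open>G\<^sub>i\<^sub>+\<^sub>1\<close> to \<open>G\<^sub>i\<close>: the coefficient of the basis
  element \<open>c\<close> in the image of \<open>b\<close> is \<open>D i c b\<close>. Elements of \<open>G\<^sub>i\<close> are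
  coefficient functions supported on \<open>basis i\<close>.\<close>

definition free_module :: "'b set \<Rightarrow> ('b \<Rightarrow> ('v, 'k::field) mpoly) set" where
  "free_module B = {f. \<forall>b. b \<notin> B \<longrightarrow> f b = 0}"

definition differential ::
  "(nat \<Rightarrow> 'b set) \<Rightarrow> (nat \<Rightarrow> 'b \<Rightarrow> 'b \<Rightarrow> ('v, 'k::field) mpoly) \<Rightarrow>
   nat \<Rightarrow> ('b \<Rightarrow> ('v, 'k) mpoly) \<Rightarrow> 'b \<Rightarrow> ('v, 'k) mpoly" where
  "differential basis D i f c =
     (if c \<in> basis i then \<Sum>b\<in>basis (Suc i). D i c b * f b else 0)"

text \<open>Tor is computed by resolving its second argument, the residue field.
  Graded free resolutions of the residue field \<open>k = S/(x\<^sub>1, \<dots>, x\<^sub>n)\<close>: in the last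
  condition, \<open>f \<mapsto> \<Sum>b\<in>basis 0. a b * f b (0)\<close> is the augmentation from \<open>G\<^sub>0\<close> onto \<open>k\<close>.\<close>

locale residue_field_resolution =
  fixes basis :: "nat \<Rightarrow> 'b set"
    and deg :: "'b \<Rightarrow> nat"
    and D :: "nat \<Rightarrow> 'b \<Rightarrow> 'b \<Rightarrow> ('v::finite, 'k::field) mpoly"
  assumes finite_basis: "finite (basis i)"
    and graded: "\<lbrakk>b \<in> basis (Suc i); c \<in> basis i; t \<in> Poly_Mapping.keys (D i c b)\<rbrakk>
      \<Longrightarrow> deg c + monom_deg t = deg b"
    and exact: "{f \<in> free_module (basis (Suc i)). differential basis D i f = (\<lambda>_. 0)}
      = differential basis D (Suc i) ` free_module (basis (Suc (Suc i)))"
    and augmented: "\<exists>a :: 'b \<Rightarrow> 'k.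
      (\<exists>b\<in>basis 0. a b \<noteq> 0) \<and> (\<forall>b\<in>basis 0. a b \<noteq> 0 \<longrightarrow> deg b = 0) \<and>
      {f \<in> free_module (basis 0). (\<Sum>b\<in>basis 0. a b * Poly_Mapping.lookup (f b) 0) = 0}
        = differential basis D 0 ` free_module (basis 1)"
begin

text \<open>\<open>Tor\<^sub>i(S/I, k)\<^sub>j\<close> is the degree-\<open>j\<close> part of the homology of \<open>S/I \<otimes> G = G/IG\<close> at
  \<open>G\<^sub>i/IG\<^sub>i\<close>. Cycles and boundaries are represented by their preimages in \<open>G\<^sub>i\<close>; both
  preimages contain the degree-\<open>j\<close> part of \<open>IG\<^sub>i\<close>, so their quotient is the homology.\<close>

definition graded_part :: "nat \<Rightarrow> nat \<Rightarrow> ('b \<Rightarrow> ('v, 'k) mpoly) set" where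
  "graded_part i j = {f \<in> free_module (basis i).
     \<forall>b\<in>basis i. \<forall>t\<in>Poly_Mapping.keys (f b). deg b + monom_deg t = j}"

definition cycles ::
  "('v, 'k) mpoly set \<Rightarrow> nat \<Rightarrow> nat \<Rightarrow> ('b \<Rightarrow> ('v, 'k) mpoly) set" where
  "cycles I i j = {f \<in> graded_part i j.
     case i of 0 \<Rightarrow> True | Suc i' \<Rightarrow> \<forall>c. differential basis D i' f c \<in> I}"

definition boundaries ::
  "('v, 'k) mpoly set \<Rightarrow> nat \<Rightarrow> nat \<Rightarrow> ('b \<Rightarrow> ('v, 'k) mpoly) set" where
  "boundaries I i j = {f \<in> graded_part i j.
     \<exists>g\<in>graded_part (Suc i) j. \<forall>c. f c - differential basis D i g c \<in> I}"

definition tor_dim :: "('v, 'k) mpoly set \<Rightarrow> nat \<Rightarrow> nat \<Rightarrow> nat" where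
  "tor_dim I i j =
     vector_space.dim (\<lambda>(a::'k) f b. Const a * f b) (cycles I i j)
     - vector_space.dim (\<lambda>(a::'k) f b. Const a * f b) (boundaries I i j)"

end

text \<open>The Koszul complex of \<open>x\<^sub>1, \<dots>, x\<^sub>n\<close>; the basis elements of \<open>K\<^sub>i\<close> are the vertex sets
  of cardinality \<open>i\<close>. The sum in the matrix entry has at most one term.\<close>

definition koszul_basis :: "nat \<Rightarrow> 'v::{finite,linorder} set set" where
  "koszul_basis i = {T. card T = i}"

definition koszul_matrix ::
  "nat \<Rightarrow> 'v::{finite,linorder} set \<Rightarrow> 'v set \<Rightarrow> ('v, 'k::field) mpoly" where
  "koszul_matrix i T U = (\<Sum>v | v \<notin> T \<and> U = insert v T. incidence_sign v T * Var v)"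

text \<open>The following lemmas establish that the Koszul complex is a graded free resolution of the
  residue field, so that it may be used to compute Tor.\<close>

lemma lookup_Var_mult:
  fixes p :: "('v, 'k::field) mpoly"
  shows "Poly_Mapping.lookup (Var v * p) t =
    (if Poly_Mapping.lookup t v = 0 then 0
     else Poly_Mapping.lookup p (t - Poly_Mapping.single v 1))"
proof -
  let ?s = "Poly_Mapping.single v (1::nat)"
  have inner: "(\<Sum>q. (Poly_Mapping.lookup p q when t = l + q)) = Poly_Mapping.lookup p (t - l)"
    if "t = l + (t - l)" for l
  proof -
    have "(\<lambda>q. (Poly_Mapping.lookup p q when t = l + q))
        = (\<lambda>q. (Poly_Mapping.lookup p q when q = t - l))"
      using that by (auto simp: fun_eq_iff when_def)
    then show ?thesis by (simp only: Sum_any_when_equal)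
  qed
  have split: "t = ?s + (t - ?s) \<longleftrightarrow> Poly_Mapping.lookup t v \<noteq> 0"
    by (auto simp: poly_mapping_eq_iff fun_eq_iff lookup_add lookup_minus lookup_single when_def)
  have none: "(\<Sum>q. (Poly_Mapping.lookup p q when t = ?s + q)) = 0"
    if "Poly_Mapping.lookup t v = 0"
  proof -
    have "t \<noteq> ?s + q" for q using that by (auto simp: lookup_add)
    then show ?thesis by simp
  qed
  have "Poly_Mapping.lookup (Var v * p) t
      = (\<Sum>l. (1 when ?s = l) * (\<Sum>q. (Poly_Mapping.lookup p q when t = l + q)))"
    by (simp add: lookup_mult Var_def lookup_single)
  also have "\<dots> = (\<Sum>l. ((\<Sum>q. (Poly_Mapping.lookup p q when t = l + q)) when l = ?s))"
    by (rule arg_cong[where f=Sum_any]) (auto simp: fun_eq_iff when_def)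
  also have "\<dots> = (\<Sum>q. (Poly_Mapping.lookup p q when t = ?s + q))" by simp
  also have "\<dots> = (if Poly_Mapping.lookup t v = 0 then 0
     else Poly_Mapping.lookup p (t - ?s))"
    using inner[of ?s] split none by auto
  finally show ?thesis .
qed

lemma keys_sign_mult:
  "Poly_Mapping.keys ((- 1) ^ m * p) = Poly_Mapping.keys (p :: ('v, 'k::field) mpoly)"
  by (cases "even m") (auto simp: in_keys_iff)

lemma lookup_sign_mult:
  "Poly_Mapping.lookup (incidence_sign v T * p) t
    = incidence_sign v T * Poly_Mapping.lookup (p :: ('v::{finite,linorder}, 'k::field) mpoly) t"
  unfolding incidence_sign_def by (cases "even (card {u \<in> T. u < v})") auto

lemma koszul_differential:
  fixes f :: "'v::{finite,linorder} set \<Rightarrow> ('v, 'k::field) mpoly"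
  assumes "f \<in> free_module (koszul_basis (Suc i))"
  shows "differential koszul_basis koszul_matrix i f T
    = (\<Sum>v\<in>- T. incidence_sign v T * Var v * f (insert v T))"
proof (cases "card T = i")
  case True
  have "(\<Sum>U\<in>koszul_basis (Suc i). koszul_matrix i T U * f U)
      = (\<Sum>U | card U = Suc i. \<Sum>v\<in>- T. (if U = insert v T
            then incidence_sign v T * Var v * f U else 0))"
    unfolding koszul_basis_def koszul_matrix_def sum_distrib_right
    by (intro sum.cong refl sum.mono_neutral_cong_left) auto
  also have "\<dots> = (\<Sum>v\<in>- T. \<Sum>U | card U = Suc i. (if U = insert v T
            then incidence_sign v T * Var v * f U else 0))"
    by (rule sum.swap)
  also have "\<dots> = (\<Sum>v\<in>- T. incidence_sign v T * Var v * f (insert v T))"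
    using True by (intro sum.cong refl) (simp add: sum.delta')
  finally show ?thesis using True by (simp add: differential_def koszul_basis_def)
next
  case False
  then have "f (insert v T) = 0" if "v \<notin> T" for v
    using assms that by (auto simp: free_module_def koszul_basis_def)
  with False show ?thesis by (simp add: differential_def koszul_basis_def)
qed

lemma differential_in_free_module:
  "differential basis D i f \<in> free_module (basis i)"
  by (auto simp: differential_def free_module_def)

lemma incidence_sign_anticommute:
  fixes u v :: "'v::{finite,linorder}"
  assumes "u \<noteq> v" "u \<notin> T" "v \<notin> T"
  shows "incidence_sign v T * incidence_sign u (insert v T)
    = - (incidence_sign u T * incidence_sign v (insert u T) :: 'r::comm_ring_1)"
proof -
  have *: "incidence_sign a (insert b T) =
      (if b < a then - incidence_sign a T else (incidence_sign a T :: 'r))"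
    if "b \<notin> T" for a b
  proof -
    have "{w \<in> insert b T. w < a}
        = (if b < a then insert b {w \<in> T. w < a} else {w \<in> T. w < a})" by auto
    then show ?thesis using that by (simp add: incidence_sign_def)
  qed
  show ?thesis using assms by (cases "u < v") (auto simp: *)
qed

lemma koszul_differential_differential:
  fixes f :: "'v::{finite,linorder} set \<Rightarrow> ('v, 'k::field) mpoly"
  assumes "f \<in> free_module (koszul_basis (Suc (Suc i)))"
  shows "differential koszul_basis koszul_matrix i
    (differential koszul_basis koszul_matrix (Suc i) f) T = 0"
proof -
  define F where "F v u = incidence_sign v T * Var v *
    (incidence_sign u (insert v T) * Var u * f (insert u (insert v T)))" for u v
  have anti: "F v u = - F u v" if "u \<noteq> v" "u \<notin> T" "v \<notin> T" for u v
  proof -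
    have "F v u = (incidence_sign v T * incidence_sign u (insert v T))
        * (Var v * Var u * f (insert u (insert v T)))"
      by (simp add: F_def mult_ac)
    also have "\<dots> = - F u v"
      unfolding incidence_sign_anticommute[OF that]
      by (simp add: F_def mult_ac insert_commute)
    finally show ?thesis .
  qed
  note inner = differential_in_free_module[of koszul_basis koszul_matrix "Suc i" f]
  let ?A = "Sigma (- T) (\<lambda>v. - insert v T)"
  have "differential koszul_basis koszul_matrix i
      (differential koszul_basis koszul_matrix (Suc i) f) T
      = (\<Sum>v\<in>- T. \<Sum>u\<in>- insert v T. F v u)"
    unfolding koszul_differential[OF inner] koszul_differential[OF assms]
    by (simp add: F_def sum_distrib_left)
  also have "\<dots> = (\<Sum>(v, u)\<in>?A. F v u)"
    by (rule sum.Sigma) auto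
  also have "\<dots> = (\<Sum>(v, u)\<in>{(v, u) \<in> ?A. v < u}. F v u) + (\<Sum>(v, u)\<in>{(v, u) \<in> ?A. u < v}. F v u)"
    by (subst sum.union_disjoint[symmetric]) (auto intro!: sum.cong)
  also have "(\<Sum>(v, u)\<in>{(v, u) \<in> ?A. u < v}. F v u)
      = (\<Sum>(v, u)\<in>{(v, u) \<in> ?A. v < u}. F u v)"
    by (rule sum.reindex_bij_witness[where i="\<lambda>(a, b). (b, a)" and j="\<lambda>(a, b). (b, a)"]) auto
  also have "\<dots> = (\<Sum>(v, u)\<in>{(v, u) \<in> ?A. v < u}. - F v u)"
  proof (intro sum.cong refl)
    fix p
    assume "p \<in> {(v, u) \<in> ?A. v < u}"
    then obtain v u where "p = (v, u)" "v \<noteq> u" "v \<notin> T" "u \<notin> T" by auto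
    with anti[of v u] show "(case p of (v, u) \<Rightarrow> F u v) = (case p of (v, u) \<Rightarrow> - F v u)"
      by simp
  qed
  also have "\<dots> = - (\<Sum>(v, u)\<in>{(v, u) \<in> ?A. v < u}. F v u)"
    unfolding sum_negf[symmetric] by (rule sum.cong) auto
  finally show ?thesis by (simp only: add.right_inverse)
qed

text \<open>Contracting homotopy in every multidegree other than 0: add the least vertex \<open>m\<close>
  occurring in the multidegree to the exterior part.\<close>

definition koszul_homotopy ::
  "('v::{finite,linorder} set \<Rightarrow> ('v, 'k::field) mpoly) \<Rightarrow> 'v set \<Rightarrow> ('v, 'k) mpoly" where
  "koszul_homotopy f T = Poly_Mapping.Abs_poly_mapping (\<lambda>t.
     let m = Min (T \<union> Poly_Mapping.keys t) in
     if m \<in> T then Poly_Mapping.lookup (f (T - {m})) (t + Poly_Mapping.single m 1) else 0)"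

lemma lookup_koszul_homotopy:
  "Poly_Mapping.lookup (koszul_homotopy f T) t = (let m = Min (T \<union> Poly_Mapping.keys t) in
     if m \<in> T then Poly_Mapping.lookup (f (T - {m})) (t + Poly_Mapping.single m 1) else 0)"
proof -
  let ?g = "\<lambda>t. let m = Min (T \<union> Poly_Mapping.keys t) in
     if m \<in> T then Poly_Mapping.lookup (f (T - {m})) (t + Poly_Mapping.single m 1) else 0"
  have "{t. ?g t \<noteq> 0} \<subseteq> (\<Union>m\<in>T. (\<lambda>s. s - Poly_Mapping.single m 1) ` Poly_Mapping.keys (f (T - {m})))"
    by (force simp: Let_def in_keys_iff image_iff split: if_splits)
  then have "finite {t. ?g t \<noteq> 0}"
    by (rule finite_subset) (auto intro!: finite_UN_I)
  then show ?thesis unfolding koszul_homotopy_def by simp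
qed

lemma koszul_homotopy_in_free_module:
  assumes "f \<in> free_module (koszul_basis i)"
  shows "koszul_homotopy f \<in> free_module (koszul_basis (Suc i))"
proof -
  have "koszul_homotopy f T = 0" if "card T \<noteq> Suc i" for T
  proof (rule poly_mapping_eqI)
    fix t
    have "f (T - {m}) = 0" if "m \<in> T" for m
    proof -
      have "card (T - {m}) \<noteq> i"
        using card_Suc_Diff1[OF _ that] \<open>card T \<noteq> Suc i\<close> by simp
      with assms show ?thesis by (simp add: free_module_def koszul_basis_def)
    qed
    then show "Poly_Mapping.lookup (koszul_homotopy f T) t = Poly_Mapping.lookup 0 t"
      by (auto simp: lookup_koszul_homotopy Let_def)
  qed
  then show ?thesis by (auto simp: free_module_def koszul_basis_def)
qed

lemma koszul_homotopy:
  fixes f :: "'v::{finite,linorder} set \<Rightarrow> ('v, 'k::field) mpoly"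
  assumes f: "f \<in> free_module (koszul_basis i)" and ne: "T \<noteq> {} \<or> t \<noteq> 0"
    and cyc: "\<And>c. T \<noteq> {} \<Longrightarrow>
      (\<Sum>v\<in>- c. incidence_sign v c * Var v * f (insert v c)) = 0"
  shows "Poly_Mapping.lookup
    (differential koszul_basis koszul_matrix i (koszul_homotopy f) T) t
    = Poly_Mapping.lookup (f T) t"
proof -
  define E where "E v = Poly_Mapping.single v (1::nat)" for v :: 'v
  define m where "m = Min (T \<union> Poly_Mapping.keys t)"
  have "T \<union> Poly_Mapping.keys t \<noteq> {}" using ne by auto
  then have m: "m \<in> T \<union> Poly_Mapping.keys t" "\<And>v. v \<in> T \<union> Poly_Mapping.keys t \<Longrightarrow> m \<le> v"
    unfolding m_def using Min_in[of "T \<union> Poly_Mapping.keys t"] by simp_all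
  have sgn: "incidence_sign m S = (1::'k)" if "S \<subseteq> T" for S
  proof -
    have "{u \<in> S. u < m} = {}" using m(2) that by force
    then show ?thesis unfolding incidence_sign_def by (simp only: card.empty power_0)
  qed
  have readd: "t - E v + E v = t" if "v \<in> Poly_Mapping.keys t" for v
    using that by (auto simp: poly_mapping_eq_iff fun_eq_iff E_def in_keys_iff
      lookup_add lookup_minus lookup_single when_def)
  have supp: "insert v T \<union> Poly_Mapping.keys (t - E v) = T \<union> Poly_Mapping.keys t"
    if "v \<in> Poly_Mapping.keys t" for v
  proof -
    have "u = v \<or> u \<in> Poly_Mapping.keys (t - E v) \<longleftrightarrow> u \<in> Poly_Mapping.keys t" for u
      using that by (cases "u = v")
        (simp_all add: in_keys_iff E_def lookup_minus lookup_single_not_eq)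
    with that show ?thesis by blast
  qed
  have L: "Poly_Mapping.lookup (differential koszul_basis koszul_matrix i (koszul_homotopy f) T) t
      = (\<Sum>v\<in>Poly_Mapping.keys t - T. incidence_sign v T *
          (if m \<in> insert v T then Poly_Mapping.lookup (f (insert v T - {m})) (t - E v + E m) else 0))"
    unfolding koszul_differential[OF koszul_homotopy_in_free_module[OF f]]
      lookup_sum mult.assoc lookup_sign_mult lookup_Var_mult
  proof (rule sum.mono_neutral_cong_right)
    show "incidence_sign v T * (if Poly_Mapping.lookup t v = 0 then 0 else
        Poly_Mapping.lookup (koszul_homotopy f (insert v T)) (t - Poly_Mapping.single v 1))
      = incidence_sign v T *
          (if m \<in> insert v T then Poly_Mapping.lookup (f (insert v T - {m})) (t - E v + E m) else 0)"
      if "v \<in> Poly_Mapping.keys t - T" for v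
      using that supp[of v] unfolding lookup_koszul_homotopy E_def[symmetric] m_def
      by (auto simp: Let_def in_keys_iff E_def)
  qed (auto simp: in_keys_iff)
  show ?thesis
  proof (cases "m \<in> T")
    case False
    then have mt: "m \<in> Poly_Mapping.keys t" using m by auto
    have "(\<Sum>v\<in>Poly_Mapping.keys t - T. incidence_sign v T *
          (if m \<in> insert v T then Poly_Mapping.lookup (f (insert v T - {m})) (t - E v + E m) else 0))
      = (\<Sum>v\<in>Poly_Mapping.keys t - T. if v = m then Poly_Mapping.lookup (f T) t else 0)"
      using False readd[OF mt] sgn[of T] by (intro sum.cong refl) auto
    with L False mt show ?thesis by (simp add: sum.delta)
  next
    case True
    let ?c = "T - {m}"
    let ?G = "\<lambda>v. incidence_sign v ?c * (if Poly_Mapping.lookup (t + E m) v = 0 then 0 else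
        Poly_Mapping.lookup (f (insert v ?c)) (t + E m - E v))"
    have "T \<noteq> {}" using True by auto
    then have "(\<Sum>v\<in>- ?c. incidence_sign v ?c * Var v * f (insert v ?c)) = 0"
      by (rule cyc)
    then have "Poly_Mapping.lookup (\<Sum>v\<in>- ?c. incidence_sign v ?c * Var v * f (insert v ?c)) (t + E m) = 0"
      by (simp only: lookup_zero)
    then have "(\<Sum>v\<in>- ?c. ?G v) = 0"
      unfolding lookup_sum mult.assoc lookup_sign_mult lookup_Var_mult E_def .
    moreover have "- ?c = insert m (- T)" using True by auto
    ultimately have "?G m + (\<Sum>v\<in>- T. ?G v) = 0" using True by simp
    moreover have "?G m = Poly_Mapping.lookup (f T) t"
      using True sgn[of ?c] by (simp add: lookup_add E_def insert_absorb)
    moreover have "(\<Sum>v\<in>- T. ?G v) = - (\<Sum>v\<in>Poly_Mapping.keys t - T. incidence_sign v T *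
          Poly_Mapping.lookup (f (insert v T - {m})) (t - E v + E m))"
      unfolding sum_negf[symmetric]
    proof (rule sum.mono_neutral_cong_right)
      show "\<forall>v\<in>- T - (Poly_Mapping.keys t - T). ?G v = 0"
        using True by (auto simp: lookup_add E_def lookup_single when_def in_keys_iff)
      fix v assume v: "v \<in> Poly_Mapping.keys t - T"
      then have vm: "v \<noteq> m" and "m \<le> v" using True m by auto
      then have "m < v" by auto
      then have "{u \<in> T. u < v} = insert m {u \<in> ?c. u < v}" using True by auto
      then have "incidence_sign v T = - (incidence_sign v ?c :: 'k)"
        by (simp add: incidence_sign_def)
      moreover have "t + E m - E v = t - E v + E m"
        using vm v by (auto simp: poly_mapping_eq_iff fun_eq_iff E_def in_keys_iff
            lookup_add lookup_minus lookup_single when_def)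
      moreover have "insert v ?c = insert v T - {m}" using vm by auto
      ultimately show "?G v = - (incidence_sign v T *
          Poly_Mapping.lookup (f (insert v T - {m})) (t - E v + E m))"
        using v by (simp add: lookup_add in_keys_iff)
    qed auto
    ultimately show ?thesis using L True by simp
  qed
qed

lemma lookup_Var_mult_0: "Poly_Mapping.lookup (Var v * p) 0 = 0"
  by (simp add: lookup_Var_mult)

lemma monom_deg_single: "monom_deg (Poly_Mapping.single v n) = n"
  by (simp add: monom_deg_def lookup_single when_def)

interpretation koszul: residue_field_resolution koszul_basis card
  "koszul_matrix :: nat \<Rightarrow> 'v::{finite,linorder} set \<Rightarrow> 'v set \<Rightarrow> ('v, 'k::field) mpoly"
proof
  let ?d = "differential koszul_basis (koszul_matrix ::
    nat \<Rightarrow> 'v set \<Rightarrow> 'v set \<Rightarrow> ('v, 'k) mpoly)"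
  show "finite (koszul_basis i :: 'v set set)" for i by simp
  show "card c + monom_deg t = card b"
    if b: "b \<in> koszul_basis (Suc i)" and c: "c \<in> koszul_basis i"
      and t: "t \<in> Poly_Mapping.keys (koszul_matrix i c b :: ('v, 'k) mpoly)"
    for i and b c :: "'v set" and t
  proof -
    obtain v where "v \<notin> c" "b = insert v c"
        "t \<in> Poly_Mapping.keys (incidence_sign v c * Var v :: ('v, 'k) mpoly)"
      using t keys_sum[of "\<lambda>v. incidence_sign v c * Var v :: ('v, 'k) mpoly"
          "{v. v \<notin> c \<and> b = insert v c}"]
      unfolding koszul_matrix_def by blast
    then show ?thesis
      by (auto simp: incidence_sign_def keys_sign_mult Var_def monom_deg_single)
  qed
  show "{f \<in> free_module (koszul_basis (Suc i)). ?d i f = (\<lambda>_. 0)}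
      = ?d (Suc i) ` free_module (koszul_basis (Suc (Suc i)))" for i
  proof (intro equalityI subsetI)
    fix f assume "f \<in> {f \<in> free_module (koszul_basis (Suc i)). ?d i f = (\<lambda>_. 0)}"
    then have f: "f \<in> free_module (koszul_basis (Suc i))" and z: "\<And>T. ?d i f T = 0"
      by (auto simp: fun_eq_iff)
    have "?d (Suc i) (koszul_homotopy f) T = f T" for T
    proof (cases "T = {}")
      case True
      with f show ?thesis
        by (simp add: differential_def koszul_basis_def free_module_def)
    next
      case False
      show ?thesis
        by (rule poly_mapping_eqI)
          (rule koszul_homotopy[OF f], use False z koszul_differential[OF f] in auto)
    qed
    then show "f \<in> ?d (Suc i) ` free_module (koszul_basis (Suc (Suc i)))"
      using koszul_homotopy_in_free_module[OF f] by (metis (no_types, lifting) ext image_eqI)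
  next
    fix f assume "f \<in> ?d (Suc i) ` free_module (koszul_basis (Suc (Suc i)))"
    then show "f \<in> {f \<in> free_module (koszul_basis (Suc i)). ?d i f = (\<lambda>_. 0)}"
      by (auto simp: differential_in_free_module koszul_differential_differential)
  qed
  have basis0: "koszul_basis 0 = {{} :: 'v set}" by (auto simp: koszul_basis_def)
  have "{f \<in> free_module (koszul_basis 0). Poly_Mapping.lookup (f {}) 0 = 0}
      = ?d 0 ` free_module (koszul_basis 1)"
  proof (intro equalityI subsetI)
    fix f :: "'v set \<Rightarrow> ('v, 'k) mpoly"
    assume "f \<in> {f \<in> free_module (koszul_basis 0). Poly_Mapping.lookup (f {}) 0 = 0}"
    then have f: "f \<in> free_module (koszul_basis 0)" and f0: "Poly_Mapping.lookup (f {}) 0 = 0"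
      by auto
    note h = koszul_homotopy_in_free_module[OF f]
    have "?d 0 (koszul_homotopy f) T = f T" for T
    proof (cases "T = {}")
      case True
      show ?thesis
      proof (rule poly_mapping_eqI)
        fix t
        show "Poly_Mapping.lookup (?d 0 (koszul_homotopy f) T) t = Poly_Mapping.lookup (f T) t"
        proof (cases "t = 0")
          case True
          with f0 \<open>T = {}\<close> show ?thesis
            by (simp add: koszul_differential[OF h] lookup_sum mult.assoc
                lookup_sign_mult lookup_Var_mult_0)
        next
          case False
          with \<open>T = {}\<close> show ?thesis by (intro koszul_homotopy[OF f]) auto
        qed
      qed
    next
      case False
      with f show ?thesis
        by (simp add: differential_def koszul_basis_def free_module_def)
    qed
    then show "f \<in> ?d 0 ` free_module (koszul_basis 1)"
      using h by (metis (no_types, lifting) One_nat_def ext image_eqI)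
  next
    fix f assume "f \<in> ?d 0 ` free_module (koszul_basis 1)"
    then obtain g where g: "g \<in> free_module (koszul_basis (Suc 0))" and "f = ?d 0 g" by auto
    then show "f \<in> {f \<in> free_module (koszul_basis 0). Poly_Mapping.lookup (f {}) 0 = 0}"
      by (simp add: differential_in_free_module koszul_differential[OF g] lookup_sum mult.assoc
          lookup_sign_mult lookup_Var_mult_0)
  qed
  then show "\<exists>a :: 'v set \<Rightarrow> 'k.
      (\<exists>b\<in>koszul_basis 0. a b \<noteq> 0) \<and> (\<forall>b\<in>koszul_basis 0. a b \<noteq> 0 \<longrightarrow> card b = 0) \<and>
      {f \<in> free_module (koszul_basis 0).
          (\<Sum>b\<in>koszul_basis 0. a b * Poly_Mapping.lookup (f b) 0) = 0}
        = ?d 0 ` free_module (koszul_basis 1)"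
    unfolding basis0 by (intro exI[of _ "\<lambda>_. 1"]) simp
qed

definition betti :: "('v::{finite,linorder}, 'k::field) mpoly set \<Rightarrow> nat \<Rightarrow> nat \<Rightarrow> nat" where
  "betti I i j = koszul.tor_dim I i j"

definition regularity :: "('v::{finite,linorder}, 'k::field) mpoly set \<Rightarrow> int" where
  "regularity I = Max {int j - int i | i j. betti I i j \<noteq> 0}"

text \<open>\<open>S/I\<close> has \<open>d\<close>-linear resolution.\<close>

definition has_linear_resolution ::
  "nat \<Rightarrow> ('v::{finite,linorder}, 'k::field) mpoly set \<Rightarrow> bool" where
  "has_linear_resolution d I \<longleftrightarrow> indeg I = enat d \<and> regularity I = int d - 1"

end

theory Submission
  imports Defs
begin

text \<open>The faces with fewer than \<open>d\<close> vertices are all subsets of that size, in all three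
  complexes, so only the faces with exactly \<open>d\<close> vertices vary. Reduced homology of a link of
  \<open>\<Delta>\<close> below the top dimension therefore has the same cycles as in \<open>\<Delta>m\<close> and at least as
  many boundaries, which gives the Buchsbaum property. The regularity is \<open>d - 1\<close> as soon as
  \<open>Tor\<^sub>i\<close> vanishes in degree \<open>i + d\<close>; there every square-free Koszul chain is a cycle modulo either
  ideal, so a chain bounding it for the smaller ideal of \<open>\<Delta>p\<close> bounds it for that of \<open>\<Delta>\<close> too.\<close>

section \<open>Boundary maps and links\<close>

text \<open>The full lower skeleton is what initial degree \<open>d\<close> of the ideal of
  \<open>\<Delta>m\<close> means, since that degree is the least size of a non-face; the bound
  \<open>d\<close> on face sizes comes from the dimension of \<open>\<Delta>p\<close>. For the
  regularity only \<open>j = i + d\<close> is a real question: for larger \<open>j\<close> a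
  square-free chain has monomials of degree above \<open>d\<close>, all of them in the ideal, and
  the value \<open>d - 1\<close> is attained because a non-face with \<open>d\<close> vertices is a
  minimal generator. The obstacle is that chains which are not square-free escape these degree
  counts, since a high power of a single variable is still supported on a face. A homotopy on those
  multidegrees makes cycles there boundaries for any complex, so that Betti numbers can be tested on
  square-free chains.\<close>

text \<open>Swapping the two vertices added to \<open>T\<close> flips the sign, so the pairs with
  \<open>v < u\<close> cancel those with \<open>u < v\<close>. Splitting by order avoids a division
  by 2 and hence covers characteristic 2.\<close>

lemma simplicial_boundary_boundary:
  fixes f :: "'v::{finite,linorder} set \<Rightarrow> 'k::field"
  shows "simplicial_boundary (simplicial_boundary f) = (\<lambda>_. 0)"
proof
  fix T
  define H where "H v u = incidence_sign v T * (incidence_sign u (insert v T)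
    * f (insert u (insert v T)))" for u v
  have anti: "H v u = - H u v" if "u \<noteq> v" "u \<notin> T" "v \<notin> T" for u v
    using incidence_sign_anticommute[OF that, where 'r='k]
    by (simp add: H_def insert_commute flip: mult.assoc)
  let ?A = "Sigma (- T) (\<lambda>v. - insert v T)"
  have "simplicial_boundary (simplicial_boundary f) T = (\<Sum>v\<in>- T. \<Sum>u\<in>- insert v T. H v u)"
    by (simp add: simplicial_boundary_def H_def sum_distrib_left)
  also have "\<dots> = (\<Sum>(v, u)\<in>?A. H v u)"
    by (rule sum.Sigma) auto
  also have "\<dots> = (\<Sum>(v, u)\<in>{(v, u) \<in> ?A. v < u}. H v u) + (\<Sum>(v, u)\<in>{(v, u) \<in> ?A. u < v}. H v u)"
    by (subst sum.union_disjoint[symmetric]) (auto intro!: sum.cong)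
  also have "(\<Sum>(v, u)\<in>{(v, u) \<in> ?A. u < v}. H v u)
      = (\<Sum>(v, u)\<in>{(v, u) \<in> ?A. v < u}. H u v)"
    by (rule sum.reindex_bij_witness[where i="\<lambda>(a, b). (b, a)" and j="\<lambda>(a, b). (b, a)"]) auto
  also have "\<dots> = (\<Sum>(v, u)\<in>{(v, u) \<in> ?A. v < u}. - H v u)"
  proof (intro sum.cong refl)
    fix p
    assume "p \<in> {(v, u) \<in> ?A. v < u}"
    then obtain v u where "p = (v, u)" "v \<noteq> u" "v \<notin> T" "u \<notin> T" by auto
    with anti[of v u] show "(case p of (v, u) \<Rightarrow> H u v) = (case p of (v, u) \<Rightarrow> - H v u)"
      by simp
  qed
  also have "\<dots> = - (\<Sum>(v, u)\<in>{(v, u) \<in> ?A. v < u}. H v u)"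
    unfolding sum_negf[symmetric] by (rule sum.cong) auto
  finally show "simplicial_boundary (simplicial_boundary f) T = 0"
    by (simp only: add.right_inverse)
qed

lemma simplicial_boundary_in_chains:
  assumes "\<And>F G. F \<in> \<Gamma> \<Longrightarrow> G \<subseteq> F \<Longrightarrow> G \<in> \<Gamma>" and "f \<in> chains \<Gamma> (i + 1)"
  shows "simplicial_boundary f \<in> chains \<Gamma> i"
  unfolding chains_def
proof (intro CollectI allI impI)
  fix T assume "simplicial_boundary f T \<noteq> 0"
  then obtain v where "v \<in> - T" and nz: "f (insert v T) \<noteq> 0"
    unfolding simplicial_boundary_def by (force elim: sum.not_neutral_contains_not_neutral)
  have "insert v T \<in> \<Gamma>" "int (card (insert v T)) - 1 = i + 1"
    using assms(2) nz by (auto simp: chains_def)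
  with assms(1)[of "insert v T" T] \<open>v \<in> - T\<close> show "T \<in> \<Gamma> \<and> int (card T) - 1 = i"
    by auto
qed

lemma link_subset_closed:
  assumes "simplicial_complex \<Delta>" "G \<in> link \<Delta> F" "G' \<subseteq> G"
  shows "G' \<in> link \<Delta> F"
proof -
  have "F \<union> G' \<subseteq> F \<union> G" using assms(3) by auto
  with assms show ?thesis unfolding link_def simplicial_complex_def by blast
qed

lemma empty_in_simplicial_complex: "simplicial_complex \<Delta> \<Longrightarrow> {} \<in> \<Delta>"
  unfolding simplicial_complex_def by blast

text \<open>Vanishing is an equality of sets, so that boundaries are cycles is a separate
  obligation; closure of \<open>\<Gamma>'\<close> under subsets serves that half.\<close>

lemma reduced_homology_vanishes_mono:
  fixes \<Gamma> \<Gamma>' :: "'v::{finite,linorder} set set"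
  assumes closed: "\<And>F G. F \<in> \<Gamma>' \<Longrightarrow> G \<subseteq> F \<Longrightarrow> G \<in> \<Gamma>'" and sub: "\<Gamma> \<subseteq> \<Gamma>'"
    and eq: "\<And>F. F \<in> \<Gamma>' \<Longrightarrow> int (card F) - 1 = i \<Longrightarrow> F \<in> \<Gamma>"
    and van: "reduced_homology_vanishes TYPE('k::field) \<Gamma> i"
  shows "reduced_homology_vanishes TYPE('k) \<Gamma>' i"
  unfolding reduced_homology_vanishes_def
proof (intro equalityI subsetI)
  fix z :: "'v set \<Rightarrow> 'k"
  assume "z \<in> {z \<in> chains \<Gamma>' i. simplicial_boundary z = (\<lambda>_. 0)}"
  then have "z \<in> {z \<in> chains \<Gamma> i. simplicial_boundary z = (\<lambda>_. 0)}"
    using eq unfolding chains_def by blast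
  then have "z \<in> simplicial_boundary ` (chains \<Gamma> (i + 1) :: ('v set \<Rightarrow> 'k) set)"
    using van unfolding reduced_homology_vanishes_def by blast
  moreover have "chains \<Gamma> (i + 1) \<subseteq> (chains \<Gamma>' (i + 1) :: ('v set \<Rightarrow> 'k) set)"
    using sub unfolding chains_def by blast
  ultimately show "z \<in> simplicial_boundary ` (chains \<Gamma>' (i + 1) :: ('v set \<Rightarrow> 'k) set)"
    by blast
next
  fix z :: "'v set \<Rightarrow> 'k"
  assume "z \<in> simplicial_boundary ` (chains \<Gamma>' (i + 1) :: ('v set \<Rightarrow> 'k) set)"
  then show "z \<in> {z \<in> chains \<Gamma>' i. simplicial_boundary z = (\<lambda>_. 0)}"
    using simplicial_boundary_in_chains[OF closed] simplicial_boundary_boundary by auto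
qed

text \<open>Disposes of faces with \<open>d\<close> vertices, whose links have dimension at most -1.
  There are no chains in degree \<open>i\<close>, but for \<open>i = -2\<close> degree
  \<open>i + 1\<close> may contain the empty face, so its boundary has to be shown zero.\<close>

lemma reduced_homology_vanishes_low:
  fixes \<Gamma> :: "'v::{finite,linorder} set set"
  assumes "i < - 1"
  shows "reduced_homology_vanishes TYPE('k::field) \<Gamma> i"
proof -
  have 1: "chains \<Gamma> i = {\<lambda>_. 0 :: 'k}" for \<Gamma> :: "'v set set"
    using assms by (auto simp: chains_def fun_eq_iff)
  have "simplicial_boundary f = (\<lambda>_. 0)" if "f \<in> chains \<Gamma> (i + 1)" for f :: "'v set \<Rightarrow> 'k"
  proof -
    have "simplicial_boundary f \<in> chains UNIV i"
      \<comment> \<open>\<open>\<Gamma>\<close> is not assumed closed under subsets, so the chain is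
        viewed in the full simplex.\<close>
      by (rule simplicial_boundary_in_chains) (use that in \<open>auto simp: chains_def\<close>)
    with 1 show ?thesis by simp
  qed
  moreover have "(\<lambda>_. 0) \<in> (chains \<Gamma> (i + 1) :: ('v set \<Rightarrow> 'k) set)" by (simp add: chains_def)
  ultimately show ?thesis
    unfolding reduced_homology_vanishes_def 1 by auto
qed

section \<open>Purity, dimension and the Buchsbaum property\<close>

lemma card_le_of_complex_dim:
  assumes "complex_dim \<Delta> = int d - 1" "F \<in> \<Delta>"
  shows "card F \<le> d"
proof -
  have "int (card F) - 1 \<le> complex_dim \<Delta>"
    unfolding complex_dim_def by (rule Max_ge) (use assms in auto)
  with assms show ?thesis by simp
qed

lemma face_in_facet:
  fixes \<Delta> :: "'v::finite set set"
  assumes "F \<in> \<Delta>"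
  obtains G where "G \<in> facets \<Delta>" "F \<subseteq> G"
proof -
  obtain G where "G \<in> {G \<in> \<Delta>. F \<subseteq> G}" "\<forall>H\<in>{G \<in> \<Delta>. F \<subseteq> G}. G \<subseteq> H \<longrightarrow> G = H"
    using finite_has_maximal2[of "{G \<in> \<Delta>. F \<subseteq> G}" F] assms by auto
  then show thesis by (intro that[of G]) (auto simp: facets_def)
qed

text \<open>A face attaining the dimension lies in a facet with \<open>d\<close> vertices, and
  purity transfers this size to the facet above \<open>F\<close>.\<close>

lemma pure_face_extends:
  fixes \<Delta> :: "'v::finite set set"
  assumes "pure \<Delta>" "complex_dim \<Delta> = int d - 1" "F \<in> \<Delta>"
  obtains G where "G \<in> \<Delta>" "F \<subseteq> G" "card G = d"
proof -
  have "Max ((\<lambda>F. int (card F) - 1) ` \<Delta>) \<in> (\<lambda>F. int (card F) - 1) ` \<Delta>"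
    by (rule Max_in) (use assms in auto)
  then obtain H where H: "H \<in> \<Delta>" "int (card H) - 1 = int d - 1"
    using assms(2) unfolding complex_dim_def by auto
  obtain G' where G': "G' \<in> facets \<Delta>" "H \<subseteq> G'" using H(1) by (rule face_in_facet)
  obtain G where G: "G \<in> facets \<Delta>" "F \<subseteq> G" using assms(3) by (rule face_in_facet)
  have "card G' = d"
    using H card_mono[OF _ G'(2)] card_le_of_complex_dim[OF assms(2), of G'] G'(1)
    by (auto simp: facets_def)
  then have "card G = d" using assms(1) G(1) G'(1) unfolding pure_def by metis
  with G show thesis by (intro that[of G]) (auto simp: facets_def)
qed

lemma buchsbaum_between:
  fixes \<Delta>m \<Delta> :: "'v::{finite,linorder} set set"
  assumes "simplicial_complex \<Delta>m" "simplicial_complex \<Delta>" "\<Delta>m \<subseteq> \<Delta>"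
    and dim_m: "complex_dim \<Delta>m = int d - 1"
    and le: "\<And>F. F \<in> \<Delta> \<Longrightarrow> card F \<le> d"
    and skel: "\<And>F :: 'v set. card F < d \<Longrightarrow> F \<in> \<Delta>m"
    and B: "buchsbaum TYPE('k::field) \<Delta>m"
  shows "buchsbaum TYPE('k) \<Delta>"
  unfolding buchsbaum_def
proof (intro conjI ballI allI impI)
  have pure_m: "pure \<Delta>m" using B by (simp add: buchsbaum_def)
  have "card F = d" if F: "F \<in> facets \<Delta>" for F
  proof (rule ccontr)
    assume "card F \<noteq> d"
    with le F have "card F < d" by (metis (no_types, lifting) facets_def le_neq_implies_less mem_Collect_eq)
    \<comment> \<open>A facet of \<open>\<Delta>\<close> that is too small would lie in
      \<open>\<Delta>m\<close>, where purity enlarges it to \<open>d\<close> vertices, against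
      maximality.\<close>
    then have "F \<in> \<Delta>m" by (rule skel)
    then obtain G where "G \<in> \<Delta>m" "F \<subseteq> G" "card G = d"
      using pure_face_extends[OF pure_m dim_m] by blast
    then show False using F \<open>card F \<noteq> d\<close> assms(3) unfolding facets_def by blast
  qed
  then show "pure \<Delta>" unfolding pure_def by simp
  fix F i assume F: "F \<in> \<Delta>" "F \<noteq> {}" and i: "i < complex_dim (link \<Delta> F)"
  have cF: "card F \<le> d" using le F by simp
  have dim_le: "complex_dim (link \<Delta> F) \<le> int d - int (card F) - 1"
    unfolding complex_dim_def
  proof (rule Max.boundedI)
    have "{} \<in> link \<Delta> F"
      using F empty_in_simplicial_complex[OF assms(2)] by (simp add: link_def)
    then show "(\<lambda>F. int (card F) - 1) ` link \<Delta> F \<noteq> {}" by blast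
    fix a assume "a \<in> (\<lambda>F. int (card F) - 1) ` link \<Delta> F"
    then obtain G where "a = int (card G) - 1" "F \<inter> G = {}" "F \<union> G \<in> \<Delta>"
      by (auto simp: link_def)
    with le[of "F \<union> G"] show "a \<le> int d - int (card F) - 1"
      by (simp add: card_Un_disjoint)
  qed simp
  show "reduced_homology_vanishes TYPE('k) (link \<Delta> F) i"
  proof (cases "card F = d")
    case True
    then show ?thesis using i dim_le by (intro reduced_homology_vanishes_low) simp
  next
    case False
    then have "card F < d" using cF by simp
    then have Fm: "F \<in> \<Delta>m" by (rule skel)
    obtain G where G: "G \<in> \<Delta>m" "F \<subseteq> G" "card G = d"
      using pure_face_extends[OF pure_m dim_m Fm] .
    \<comment> \<open>This face attains the upper bound \<open>dim_le\<close> already in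
      \<open>\<Delta>m\<close>, so \<open>i\<close> is also below the dimension of the link in
      \<open>\<Delta>m\<close>.\<close>
    have "G - F \<in> link \<Delta>m F"
      using G assms(1) unfolding link_def simplicial_complex_def by (auto simp: Un_absorb1)
    then have "int (card (G - F)) - 1 \<le> complex_dim (link \<Delta>m F)"
      unfolding complex_dim_def by (intro Max_ge) auto
    moreover have "card (G - F) + card F = d"
      using G by (metis card_Diff_subset card_mono finite le_add_diff_inverse2)
    ultimately have "i < complex_dim (link \<Delta>m F)" using i dim_le by linarith
    then have "reduced_homology_vanishes TYPE('k) (link \<Delta>m F) i"
      using B Fm F unfolding buchsbaum_def by blast
    then show ?thesis
    proof (rule reduced_homology_vanishes_mono[rotated 3])
      show "H \<in> link \<Delta> F" if "G \<in> link \<Delta> F" "H \<subseteq> G" for G H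
        using link_subset_closed[OF assms(2)] that by blast
      show "link \<Delta>m F \<subseteq> link \<Delta> F" using assms(3) by (auto simp: link_def)
      show "G \<in> link \<Delta>m F" if G: "G \<in> link \<Delta> F" "int (card G) - 1 = i" for G
      proof -
        \<comment> \<open>\<open>G\<close> has \<open>i + 1\<close> vertices and
          \<open>i + 1 \<le> d - card F - 1\<close>, so the union stays within the common
          skeleton.\<close>
        have "card (F \<union> G) < d" using G i dim_le by (simp add: link_def card_Un_disjoint)
        then have "F \<union> G \<in> \<Delta>m" by (rule skel)
        with G assms(1) show ?thesis unfolding link_def simplicial_complex_def
          by (metis (no_types, lifting) mem_Collect_eq sup_ge2)
      qed
    qed
  qed
qed

section \<open>Stanley--Reisner ideals\<close>

definition squarefree_monom :: "'v::finite set \<Rightarrow> ('v \<Rightarrow>\<^sub>0 nat)" where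
  "squarefree_monom F = (\<Sum>v\<in>F. Poly_Mapping.single v 1)"

lemma lookup_squarefree_monom: "Poly_Mapping.lookup (squarefree_monom F) v = (if v \<in> F then 1 else 0)"
  unfolding squarefree_monom_def lookup_sum by (simp add: lookup_single when_def)

lemma keys_squarefree_monom [simp]: "Poly_Mapping.keys (squarefree_monom F) = F"
  by (auto simp: in_keys_iff lookup_squarefree_monom split: if_splits)

lemma monom_deg_squarefree_monom [simp]: "monom_deg (squarefree_monom F) = card F"
  by (simp add: monom_deg_def lookup_squarefree_monom sum.If_cases)

lemma monom_deg_add: "monom_deg (s + t) = monom_deg s + monom_deg t"
  by (simp add: monom_deg_def lookup_add sum.distrib)

lemma card_keys_le_monom_deg: "card (Poly_Mapping.keys t) \<le> monom_deg t"
proof -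
  have "(\<Sum>v\<in>Poly_Mapping.keys t. 1) \<le> (\<Sum>v\<in>Poly_Mapping.keys t. Poly_Mapping.lookup t v)"
    by (rule sum_mono) (simp add: in_keys_iff)
  also have "\<dots> \<le> monom_deg t"
    unfolding monom_deg_def by (rule sum_mono2) auto
  finally show ?thesis by simp
qed

lemma card_keys_eq_monom_deg:
  assumes "\<And>v. Poly_Mapping.lookup t v < 2"
  shows "card (Poly_Mapping.keys t) = monom_deg t"
proof -
  have *: "Poly_Mapping.lookup t v = (if v \<in> Poly_Mapping.keys t then 1 else 0)" for v
    using assms[of v] by (auto simp: in_keys_iff)
  have "monom_deg t = (\<Sum>v\<in>UNIV. if v \<in> Poly_Mapping.keys t then 1 else 0)"
    unfolding monom_deg_def by (intro sum.cong refl *)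
  then show ?thesis by (simp add: sum.If_cases)
qed

lemma prod_Var: "(\<Prod>v\<in>F. Var v) = Poly_Mapping.single (squarefree_monom F) (1::'k::field)"
  for F :: "'v::finite set"
proof (induction F rule: infinite_finite_induct)
  case empty
  show ?case by (simp add: squarefree_monom_def)
next
  case (insert v F)
  then show ?case by (simp add: squarefree_monom_def Var_def mult_single)
qed simp

text \<open>The ideal is monomial, so membership is tested coefficientwise. Multiplication only
  enlarges supports and non-faces are closed upwards; conversely, each monomial is a multiple of the
  square-free monomial of its support.\<close>

lemma stanley_reisner_ideal_iff:
  fixes p :: "('v::finite, 'k::field) mpoly"
  assumes "simplicial_complex \<Delta>"
  shows "p \<in> stanley_reisner_ideal \<Delta> \<longleftrightarrow> (\<forall>t. Poly_Mapping.keys t \<in> \<Delta> \<longrightarrow> Poly_Mapping.lookup p t = 0)"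
proof -
  interpret M: module "(*) :: ('v, 'k) mpoly \<Rightarrow> ('v, 'k) mpoly \<Rightarrow> ('v, 'k) mpoly"
    by unfold_locales (simp_all add: algebra_simps)
  let ?I = "stanley_reisner_ideal \<Delta> :: ('v, 'k) mpoly set"
  let ?J = "{p :: ('v, 'k) mpoly. \<forall>t. Poly_Mapping.keys t \<in> \<Delta> \<longrightarrow> Poly_Mapping.lookup p t = 0}"
  have "M.subspace ?J"
  proof (rule M.subspaceI)
    fix c p :: "('v, 'k) mpoly" assume p: "p \<in> ?J"
    show "c * p \<in> ?J"
    proof (intro CollectI allI impI, rule ccontr)
      fix t assume t: "Poly_Mapping.keys t \<in> \<Delta>" "Poly_Mapping.lookup (c * p) t \<noteq> 0"
      then obtain a b where ab: "t = a + b" "b \<in> Poly_Mapping.keys p"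
        using keys_mult[of c p] by (auto simp: in_keys_iff)
      then have "Poly_Mapping.keys b \<subseteq> Poly_Mapping.keys t" by (auto simp: in_keys_iff lookup_add)
      then have "Poly_Mapping.keys b \<in> \<Delta>" using t assms unfolding simplicial_complex_def by blast
      with p ab(2) show False by (simp add: in_keys_iff)
    qed
  qed (auto simp: lookup_add)
  moreover have "(\<lambda>F. \<Prod>v\<in>F. Var v) ` {F. F \<notin> \<Delta>} \<subseteq> ?J"
    by (auto simp: prod_Var lookup_single when_def)
  ultimately have "?I \<subseteq> ?J"
    unfolding stanley_reisner_ideal_def by (rule M.span_minimal[rotated])
  moreover have "p \<in> ?I" if p: "p \<in> ?J" for p
  proof -
    have "Poly_Mapping.single t (Poly_Mapping.lookup p t) \<in> ?I" if "t \<in> Poly_Mapping.keys p" for t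
    proof -
      have "Poly_Mapping.keys t \<notin> \<Delta>" using p that by (auto simp: in_keys_iff)
      then have "Poly_Mapping.single (squarefree_monom (Poly_Mapping.keys t)) 1 \<in> ?I"
        unfolding stanley_reisner_ideal_def prod_Var by (intro M.span_base) auto
      then have "Poly_Mapping.single (t - squarefree_monom (Poly_Mapping.keys t)) (Poly_Mapping.lookup p t)
          * Poly_Mapping.single (squarefree_monom (Poly_Mapping.keys t)) 1 \<in> ?I"
        unfolding stanley_reisner_ideal_def by (rule M.span_scale)
      moreover have "t - squarefree_monom (Poly_Mapping.keys t) + squarefree_monom (Poly_Mapping.keys t) = t"
        by (rule poly_mapping_eqI)
          (auto simp: lookup_add lookup_minus lookup_squarefree_monom in_keys_iff)
      ultimately show ?thesis by (simp add: mult_single)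
    qed
    then have "(\<Sum>t\<in>Poly_Mapping.keys p. Poly_Mapping.single t (Poly_Mapping.lookup p t)) \<in> ?I"
      unfolding stanley_reisner_ideal_def by (rule M.span_sum)
    moreover have "(\<Sum>t\<in>Poly_Mapping.keys p. Poly_Mapping.single t (Poly_Mapping.lookup p t)) = p"
      by (rule poly_mapping_eqI)
        (simp add: lookup_sum lookup_single when_def in_keys_iff sum.delta)
    ultimately show ?thesis by simp
  qed
  ultimately show ?thesis by blast
qed

text \<open>A non-face gives a generator of degree its size, and a monomial of degree
  \<open>j\<close> in the ideal has a non-face of size at most \<open>j\<close> as support.\<close>

lemma indeg_stanley_reisner_ideal:
  fixes \<Delta> :: "'v::finite set set"
  assumes \<Delta>: "simplicial_complex \<Delta>"
  shows "indeg (stanley_reisner_ideal \<Delta> :: ('v, 'k::field) mpoly set) = enat d \<longleftrightarrow>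
    (\<forall>F. card F < d \<longrightarrow> F \<in> \<Delta>) \<and> (\<exists>F. card F = d \<and> F \<notin> \<Delta>)"
proof -
  let ?I = "stanley_reisner_ideal \<Delta> :: ('v, 'k) mpoly set"
  let ?J = "{j. \<exists>f\<in>?I. f \<noteq> 0 \<and> homogeneous j f}"
  have nonface: "card F \<in> ?J" if "F \<notin> \<Delta>" for F
    using that by (intro CollectI bexI[of _ "Poly_Mapping.single (squarefree_monom F) 1"])
      (auto simp: homogeneous_def stanley_reisner_ideal_iff[OF \<Delta>] lookup_single when_def
        simp flip: keys_eq_empty)
  have small: "\<exists>F. F \<notin> \<Delta> \<and> card F \<le> j" if j: "j \<in> ?J" for j
  proof -
    obtain f where f: "f \<in> ?I" "f \<noteq> 0" "homogeneous j f" using j by auto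
    then obtain t where t: "t \<in> Poly_Mapping.keys f" by (metis all_not_in_conv keys_eq_empty)
    then have "Poly_Mapping.keys t \<notin> \<Delta>" using f(1) by (auto simp: stanley_reisner_ideal_iff[OF \<Delta>] in_keys_iff)
    moreover have "card (Poly_Mapping.keys t) \<le> j"
      using card_keys_le_monom_deg[of t] f(3) t by (simp add: homogeneous_def)
    ultimately show ?thesis by blast
  qed
  show ?thesis
  proof
    assume "indeg ?I = enat d"
    then have Inf: "Inf (enat ` ?J) = enat d" by (simp add: indeg_def)
    have low: "F \<in> \<Delta>" if "card F < d" for F
    proof (rule ccontr)
      assume "F \<notin> \<Delta>"
      then have "Inf (enat ` ?J) \<le> enat (card F)" using nonface by (intro Inf_lower) blast
      with Inf that show False by simp
    qed
    \<comment> \<open>The infimum of the empty set is infinity, so a finite value forces degrees to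
      exist, and then the infimum is one of them.\<close>
    have "enat ` ?J \<noteq> {}"
    proof
      assume "enat ` ?J = {}"
      with Inf show False unfolding Inf_enat_def by (simp only: if_True) simp
    qed
    moreover from this obtain x where "x \<in> enat ` ?J" by blast
    then have "(LEAST x. x \<in> enat ` ?J) \<in> enat ` ?J" by (rule LeastI)
    ultimately have "Inf (enat ` ?J) \<in> enat ` ?J" unfolding Inf_enat_def by (simp only: if_False)
    then have "d \<in> ?J" using Inf by auto
    then obtain F where F: "F \<notin> \<Delta>" "card F \<le> d" using small by blast
    with low have "card F = d" by (meson le_neq_implies_less)
    with F low show "(\<forall>F. card F < d \<longrightarrow> F \<in> \<Delta>) \<and> (\<exists>F. card F = d \<and> F \<notin> \<Delta>)" by blast
  next
    assume R: "(\<forall>F. card F < d \<longrightarrow> F \<in> \<Delta>) \<and> (\<exists>F. card F = d \<and> F \<notin> \<Delta>)"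
    show "indeg ?I = enat d"
      unfolding indeg_def
    proof (rule antisym)
      show "Inf (enat ` ?J) \<le> enat d" using R nonface by (intro Inf_lower) blast
      show "enat d \<le> Inf (enat ` ?J)"
      proof (rule Inf_greatest)
        fix x assume "x \<in> enat ` ?J"
        then obtain j where "x = enat j" "j \<in> ?J" by blast
        moreover obtain F where "F \<notin> \<Delta>" "card F \<le> j" using small \<open>j \<in> ?J\<close> by blast
        ultimately show "enat d \<le> x" using R by (meson enat_ord_simps(1) le_less_linear le_trans)
      qed
    qed
  qed
qed

section \<open>Koszul cycles and boundaries in coordinates\<close>

text \<open>The Koszul differential read at basis element \<open>T\<close> and monomial
  \<open>t\<close>. It carries no homological degree, so one cycle criterion covers degree 0
  too.\<close>

definition koszul_coeff ::
  "('v::{finite,linorder} set \<Rightarrow> ('v, 'k::field) mpoly) \<Rightarrow> 'v set \<Rightarrow> ('v \<Rightarrow>\<^sub>0 nat) \<Rightarrow> 'k" where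
  "koszul_coeff f T t = (\<Sum>v\<in>- T. incidence_sign v T *
     (if Poly_Mapping.lookup t v = 0 then 0 else Poly_Mapping.lookup (f (insert v T)) (t - Poly_Mapping.single v 1)))"

lemma lookup_koszul_differential:
  assumes "f \<in> free_module (koszul_basis (Suc i))"
  shows "Poly_Mapping.lookup (differential koszul_basis koszul_matrix i f T) t = koszul_coeff f T t"
  unfolding koszul_differential[OF assms] koszul_coeff_def
  by (simp add: lookup_sum mult.assoc lookup_sign_mult lookup_Var_mult)

lemma graded_part_iff:
  fixes f :: "'v::{finite,linorder} set \<Rightarrow> ('v, 'k::field) mpoly"
  shows "f \<in> koszul.graded_part i j \<longleftrightarrow>
    (\<forall>T t. Poly_Mapping.lookup (f T) t \<noteq> 0 \<longrightarrow> card T = i \<and> i + monom_deg t = j)"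
proof -
  have *: "f b = 0 \<longleftrightarrow> (\<forall>t. Poly_Mapping.lookup (f b) t = 0)" for b
    by (metis lookup_zero poly_mapping_eqI)
  then show ?thesis
    unfolding koszul.graded_part_def free_module_def koszul_basis_def mem_Collect_eq Ball_def
      in_keys_iff * by (metis (no_types, lifting))
qed

lemma graded_part_free: "f \<in> koszul.graded_part i j \<Longrightarrow> f \<in> free_module (koszul_basis i)"
  by (simp add: koszul.graded_part_def)

lemma graded_part_add:
  fixes f g :: "'v::{finite,linorder} set \<Rightarrow> ('v, 'k::field) mpoly"
  assumes "f \<in> koszul.graded_part i j" "g \<in> koszul.graded_part i j"
  shows "f + g \<in> koszul.graded_part i j"
  using assms unfolding graded_part_iff by (auto simp: lookup_add) (metis add.right_neutral)+

lemma cycles_iff: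
  fixes f :: "'v::{finite,linorder} set \<Rightarrow> ('v, 'k::field) mpoly"
  assumes \<Delta>: "simplicial_complex \<Delta>"
  shows "f \<in> koszul.cycles (stanley_reisner_ideal \<Delta>) i j \<longleftrightarrow> f \<in> koszul.graded_part i j \<and>
    (\<forall>T t. Poly_Mapping.keys t \<in> \<Delta> \<longrightarrow> koszul_coeff f T t = 0)"
proof (cases i)
  case 0
  have "koszul_coeff f T t = 0" if "f \<in> koszul.graded_part 0 j" for T t
  proof -
    have *: "f (insert v T) = 0" for v
      using graded_part_free[OF that] by (simp add: free_module_def koszul_basis_def)
    show ?thesis unfolding koszul_coeff_def * by (simp cong: if_cong)
  qed
  with 0 show ?thesis by (auto simp: koszul.cycles_def)
next
  case (Suc i')
  then show ?thesis
    using lookup_koszul_differential[OF graded_part_free[of f i j, unfolded Suc]]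
    by (auto simp: koszul.cycles_def stanley_reisner_ideal_iff[OF \<Delta>])
qed

lemma boundaries_iff:
  fixes f :: "'v::{finite,linorder} set \<Rightarrow> ('v, 'k::field) mpoly"
  assumes \<Delta>: "simplicial_complex \<Delta>"
  shows "f \<in> koszul.boundaries (stanley_reisner_ideal \<Delta>) i j \<longleftrightarrow> f \<in> koszul.graded_part i j \<and>
    (\<exists>g\<in>koszul.graded_part (Suc i) j. \<forall>T t. Poly_Mapping.keys t \<in> \<Delta> \<longrightarrow> Poly_Mapping.lookup (f T) t = koszul_coeff g T t)"
proof -
  have "(\<exists>g\<in>koszul.graded_part (Suc i) j. \<forall>T.
        f T - differential koszul_basis koszul_matrix i g T \<in> stanley_reisner_ideal \<Delta>) \<longleftrightarrow>
      (\<exists>g\<in>koszul.graded_part (Suc i) j. \<forall>T t. Poly_Mapping.keys t \<in> \<Delta> \<longrightarrow> Poly_Mapping.lookup (f T) t = koszul_coeff g T t)"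
    by (intro bex_cong refl) (simp add: stanley_reisner_ideal_iff[OF \<Delta>] lookup_minus
        lookup_koszul_differential[OF graded_part_free])
  then show ?thesis by (simp add: koszul.boundaries_def)
qed

text \<open>Modulo the ideal, \<open>f\<close> is the differential of \<open>g\<close>. Evaluating
  \<open>koszul_coeff f\<close> at \<open>t\<close> uses only divisors of \<open>t\<close>, whose
  supports are again faces, so \<open>f\<close> may be replaced by that differential.\<close>

lemma boundaries_subset_cycles:
  fixes \<Delta> :: "'v::{finite,linorder} set set"
  assumes \<Delta>: "simplicial_complex \<Delta>"
  shows "koszul.boundaries (stanley_reisner_ideal \<Delta>) i j
    \<subseteq> (koszul.cycles (stanley_reisner_ideal \<Delta>) i j :: ('v set \<Rightarrow> ('v, 'k::field) mpoly) set)"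
proof (cases i)
  case 0
  then show ?thesis by (auto simp: koszul.cycles_def koszul.boundaries_def)
next
  case (Suc i')
  show ?thesis
  proof
    fix f :: "'v set \<Rightarrow> ('v, 'k) mpoly"
    assume "f \<in> koszul.boundaries (stanley_reisner_ideal \<Delta>) i j"
    then obtain g where f: "f \<in> koszul.graded_part i j"
      and g: "g \<in> koszul.graded_part (Suc i) j"
      and fg: "\<And>T t. Poly_Mapping.keys t \<in> \<Delta> \<Longrightarrow> Poly_Mapping.lookup (f T) t = koszul_coeff g T t"
      unfolding boundaries_iff[OF \<Delta>] by blast
    let ?h = "differential koszul_basis koszul_matrix i g"
    have "koszul_coeff f T t = 0" if t: "Poly_Mapping.keys t \<in> \<Delta>" for T t
    proof -
      have "Poly_Mapping.keys (t - Poly_Mapping.single v 1) \<in> \<Delta>" for v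
      proof -
        have "Poly_Mapping.keys (t - Poly_Mapping.single v 1) \<subseteq> Poly_Mapping.keys t" by (auto simp: in_keys_iff lookup_minus)
        then show ?thesis using t \<Delta> unfolding simplicial_complex_def by blast
      qed
      then have "koszul_coeff f T t = koszul_coeff ?h T t"
        unfolding koszul_coeff_def
        by (simp add: fg lookup_koszul_differential[OF graded_part_free[OF g]] del: One_nat_def
            cong: if_cong)
      also have "\<dots> = Poly_Mapping.lookup (differential koszul_basis koszul_matrix i' ?h T) t"
        unfolding Suc
        by (rule lookup_koszul_differential[symmetric], rule differential_in_free_module)
      also have "\<dots> = 0"
        using koszul_differential_differential[OF graded_part_free[OF g, unfolded Suc]]
        by (simp add: Suc)
      finally show ?thesis .
    qed
    with f show "f \<in> koszul.cycles (stanley_reisner_ideal \<Delta>) i j"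
      unfolding cycles_iff[OF \<Delta>] by blast
  qed
qed

section \<open>Betti numbers\<close>

lemma lookup_Const_mult: "Poly_Mapping.lookup (Const a * p) t = a * Poly_Mapping.lookup p t"
  unfolding Const_def mult_map_scale_conv_mult[symmetric]
  by (simp add: Poly_Mapping.map.rep_eq when_def)

lemma vector_space_mpoly_functions:
  "vector_space (\<lambda>(a::'k::field) (f :: 'b \<Rightarrow> ('v, 'k) mpoly) b. Const a * f b)"
  by unfold_locales (intro ext poly_mapping_eqI,
    simp add: lookup_Const_mult lookup_add distrib_left distrib_right mult.assoc)+

text \<open>A basis of \<open>U\<close> extends to one of \<open>W\<close>, which is finite and no
  larger. The finite spanning set matters because \<open>dim\<close> is 0 in infinite
  dimension.\<close>

lemma (in vector_space) subspace_eqI_dim: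
  assumes "subspace U" "U \<subseteq> W" "W \<subseteq> span X" "finite X" "dim W \<le> dim U"
  shows "U = W"
proof -
  obtain B where B: "B \<subseteq> U" "independent B" "U \<subseteq> span B"
    using maximal_independent_subset[of U] by blast
  obtain C where C: "B \<subseteq> C" "C \<subseteq> W" "independent C" "W \<subseteq> span C"
    using maximal_independent_subset_extend[of B W] B assms(2) by blast
  have "finite C"
    using independent_span_bound[OF assms(4) C(3)] C(2) assms(3) by blast
  moreover have "card C \<le> card B"
    using basis_card_eq_dim[OF B(1) B(3) B(2)] basis_card_eq_dim[OF C(2) C(4) C(3)] assms(5) by simp
  ultimately have "B = C" using C(1) by (metis card_seteq)
  then have "W \<subseteq> U" using C(4) span_minimal[OF B(1) assms(1)] by blast
  with assms(2) show ?thesis by blast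
qed

lemma finite_monom_deg_le: "finite {t :: 'v::finite \<Rightarrow>\<^sub>0 nat. monom_deg t \<le> j}"
proof (rule inj_on_finite)
  show "inj_on Poly_Mapping.lookup {t :: 'v \<Rightarrow>\<^sub>0 nat. monom_deg t \<le> j}"
    by (intro inj_onI) (simp only: poly_mapping_eq_iff)
  show "finite {h :: 'v \<Rightarrow> nat. \<forall>v. (v \<in> UNIV \<longrightarrow> h v \<in> {..j}) \<and> (v \<notin> UNIV \<longrightarrow> h v = 0)}"
    by (rule finite_set_of_finite_funs) auto
  have "Poly_Mapping.lookup t v \<le> monom_deg t" for t v
    unfolding monom_deg_def by (rule member_le_sum) auto
  then show "Poly_Mapping.lookup ` {t :: 'v \<Rightarrow>\<^sub>0 nat. monom_deg t \<le> j}
      \<subseteq> {h :: 'v \<Rightarrow> nat. \<forall>v. (v \<in> UNIV \<longrightarrow> h v \<in> {..j}) \<and> (v \<notin> UNIV \<longrightarrow> h v = 0)}"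
    using order_trans by fastforce
qed

lemma graded_part_subset_span:
  obtains X where "finite X"
    "(koszul.graded_part i j :: ('v::{finite,linorder} set \<Rightarrow> ('v, 'k::field) mpoly) set)
      \<subseteq> module.span (\<lambda>(a::'k) f b. Const a * f b) X"
proof -
  interpret V: vector_space "\<lambda>(a::'k) (f :: 'v set \<Rightarrow> ('v, 'k) mpoly) b. Const a * f b"
    by (rule vector_space_mpoly_functions)
  define e :: "'v set \<Rightarrow> ('v \<Rightarrow>\<^sub>0 nat) \<Rightarrow> 'v set \<Rightarrow> ('v, 'k) mpoly"
    where "e c t = (\<lambda>b. if b = c then Poly_Mapping.single t 1 else 0)" for c t
  let ?M = "{t :: 'v \<Rightarrow>\<^sub>0 nat. monom_deg t \<le> j}"
  have eval: "(\<Sum>x\<in>A. H x) b = (\<Sum>x\<in>A. H x b)" for A b and H :: "'c \<Rightarrow> 'v set \<Rightarrow> ('v, 'k) mpoly"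
    by (induction A rule: infinite_finite_induct) auto
  show thesis
  proof
    show "finite (case_prod e ` (UNIV \<times> ?M))"
      by (intro finite_imageI finite_cartesian_product finite finite_monom_deg_le)
    show "koszul.graded_part i j \<subseteq> V.span (case_prod e ` (UNIV \<times> ?M))"
    proof
      fix f :: "'v set \<Rightarrow> ('v, 'k) mpoly" assume f: "f \<in> koszul.graded_part i j"
      have "(\<Sum>(c, t)\<in>UNIV \<times> ?M. (\<lambda>b. Const (Poly_Mapping.lookup (f c) t) * e c t b)) = f"
      proof (intro ext poly_mapping_eqI)
        fix b s
        have "Poly_Mapping.lookup ((\<Sum>(c, t)\<in>UNIV \<times> ?M. (\<lambda>b. Const (Poly_Mapping.lookup (f c) t) * e c t b)) b) s
            = (\<Sum>c\<in>UNIV. \<Sum>t\<in>?M. Poly_Mapping.lookup (Const (Poly_Mapping.lookup (f c) t) * e c t b) s)"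
          by (simp add: sum.cartesian_product[symmetric] eval lookup_sum)
        also have "\<dots> = (\<Sum>c\<in>UNIV. if c = b then \<Sum>t\<in>?M. if t = s then Poly_Mapping.lookup (f c) t else 0 else 0)"
          by (intro sum.cong refl) (auto simp: lookup_Const_mult e_def lookup_single when_def intro!: sum.cong)
        also have "\<dots> = (if s \<in> ?M then Poly_Mapping.lookup (f b) s else 0)"
          using finite_monom_deg_le[of j, where 'v='v] by (simp add: sum.delta)
        \<comment> \<open>A nonzero coefficient forces \<open>i + monom_deg s = j\<close>, so
          cutting off at degree \<open>j\<close> loses nothing.\<close>
        also have "\<dots> = Poly_Mapping.lookup (f b) s"
          using f unfolding graded_part_iff by (metis (mono_tags, lifting) le_add2 mem_Collect_eq)
        finally show "Poly_Mapping.lookup ((\<Sum>(c, t)\<in>UNIV \<times> ?M. (\<lambda>b. Const (Poly_Mapping.lookup (f c) t) * e c t b)) b) s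
          = Poly_Mapping.lookup (f b) s" .
      qed
      moreover have "(\<Sum>(c, t)\<in>UNIV \<times> ?M. (\<lambda>b. Const (Poly_Mapping.lookup (f c) t) * e c t b))
          \<in> V.span (case_prod e ` (UNIV \<times> ?M))"
        by (rule V.span_sum, clarify, rule V.span_scale, rule V.span_base) auto
      ultimately show "f \<in> V.span (case_prod e ` (UNIV \<times> ?M))" by simp
    qed
  qed
qed

lemma koszul_coeff_add: "koszul_coeff (f + g) T t = koszul_coeff f T t + koszul_coeff g T t"
  unfolding koszul_coeff_def sum.distrib[symmetric]
  by (rule sum.cong) (auto simp: lookup_add algebra_simps)

lemma koszul_coeff_scale:
  "koszul_coeff (\<lambda>b. Const a * f b) T t = a * koszul_coeff f T t"
  unfolding koszul_coeff_def sum_distrib_left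
  by (rule sum.cong) (auto simp: lookup_Const_mult algebra_simps)

lemma koszul_coeff_zero: "koszul_coeff 0 T t = 0"
  by (simp add: koszul_coeff_def cong: if_cong)

text \<open>The truncated difference of dimensions is 0 exactly when the cycles have no larger
  dimension than the boundaries; finite dimension then turns this into equality of the two
  spaces.\<close>

lemma betti_eq_0_iff:
  fixes \<Delta> :: "'v::{finite,linorder} set set"
  assumes \<Delta>: "simplicial_complex \<Delta>"
  shows "betti (stanley_reisner_ideal \<Delta> :: ('v, 'k::field) mpoly set) i j = 0 \<longleftrightarrow>
    (koszul.cycles (stanley_reisner_ideal \<Delta>) i j :: ('v set \<Rightarrow> ('v, 'k) mpoly) set)
      \<subseteq> koszul.boundaries (stanley_reisner_ideal \<Delta>) i j"
    (is "_ \<longleftrightarrow> ?Z \<subseteq> ?B")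
proof -
  interpret V: vector_space "\<lambda>(a::'k) (f :: 'v set \<Rightarrow> ('v, 'k) mpoly) b. Const a * f b"
    by (rule vector_space_mpoly_functions)
  obtain X where X: "finite X" "(koszul.graded_part i j :: ('v set \<Rightarrow> ('v, 'k) mpoly) set) \<subseteq> V.span X"
    by (rule graded_part_subset_span)
  have gr_scale: "(\<lambda>b. Const a * f b) \<in> koszul.graded_part i j"
    if "f \<in> koszul.graded_part i j" for f :: "'v set \<Rightarrow> ('v, 'k) mpoly" and i a
    using that unfolding graded_part_iff by (auto simp: lookup_Const_mult)
  have gr_zero: "0 \<in> (koszul.graded_part i j :: ('v set \<Rightarrow> ('v, 'k) mpoly) set)" for i
    unfolding graded_part_iff by simp
  have "V.subspace ?B"
  proof (rule V.subspaceI)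
    show "0 \<in> ?B"
      unfolding boundaries_iff[OF \<Delta>] using gr_zero by (auto intro!: bexI[of _ 0] simp: koszul_coeff_zero)
    show "f + f' \<in> ?B" if "f \<in> ?B" "f' \<in> ?B" for f f'
    proof -
      obtain g g' where "f \<in> koszul.graded_part i j" "f' \<in> koszul.graded_part i j"
        "g \<in> koszul.graded_part (Suc i) j" "g' \<in> koszul.graded_part (Suc i) j"
        "\<forall>T t. Poly_Mapping.keys t \<in> \<Delta> \<longrightarrow> Poly_Mapping.lookup (f T) t = koszul_coeff g T t"
        "\<forall>T t. Poly_Mapping.keys t \<in> \<Delta> \<longrightarrow> Poly_Mapping.lookup (f' T) t = koszul_coeff g' T t"
        using \<open>f \<in> ?B\<close> \<open>f' \<in> ?B\<close> unfolding boundaries_iff[OF \<Delta>] by blast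
      then show ?thesis
        unfolding boundaries_iff[OF \<Delta>]
        by (intro conjI bexI[of _ "g + g'"] graded_part_add) (auto simp: koszul_coeff_add lookup_add)
    qed
    show "(\<lambda>b. Const a * f b) \<in> ?B" if "f \<in> ?B" for f a
    proof -
      obtain g where "f \<in> koszul.graded_part i j" "g \<in> koszul.graded_part (Suc i) j"
        "\<forall>T t. Poly_Mapping.keys t \<in> \<Delta> \<longrightarrow> Poly_Mapping.lookup (f T) t = koszul_coeff g T t"
        using \<open>f \<in> ?B\<close> unfolding boundaries_iff[OF \<Delta>] by blast
      then show ?thesis
        unfolding boundaries_iff[OF \<Delta>]
        by (intro conjI bexI[of _ "\<lambda>b. Const a * g b"] gr_scale)
          (auto simp: koszul_coeff_scale lookup_Const_mult)
    qed
  qed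
  moreover have BZ: "?B \<subseteq> ?Z" by (rule boundaries_subset_cycles[OF \<Delta>])
  moreover have "?Z \<subseteq> V.span X" using X(2) by (auto simp: koszul.cycles_def)
  ultimately have "V.dim ?Z \<le> V.dim ?B \<longleftrightarrow> ?Z = ?B"
    using V.subspace_eqI_dim[OF _ _ _ X(1)] by (metis order_refl)
  then show ?thesis
    using BZ unfolding betti_def koszul.tor_dim_def by auto
qed

section \<open>Reduction to square-free multidegrees\<close>

lemma minus_single_add:
  "Poly_Mapping.lookup t v \<noteq> 0 \<Longrightarrow> t - Poly_Mapping.single v 1 + Poly_Mapping.single v (1::nat) = t"
  by (rule poly_mapping_eqI) (auto simp: lookup_add lookup_minus lookup_single when_def)

text \<open>The Koszul differential preserves the multidegree, which makes any choice depending only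
  on the multidegree consistent across its summands.\<close>

lemma shift_monom_removed:
  assumes "Poly_Mapping.lookup t v \<noteq> 0" "v \<notin> T"
  shows "t - Poly_Mapping.single v 1 + squarefree_monom (insert v T) = t + squarefree_monom T"
  by (rule poly_mapping_eqI)
    (use assms in \<open>auto simp: lookup_add lookup_minus lookup_single lookup_squarefree_monom when_def\<close>)

lemma shift_monom_added:
  assumes "v \<in> T"
  shows "t + Poly_Mapping.single v 1 + squarefree_monom (T - {v}) = t + squarefree_monom T"
  by (rule poly_mapping_eqI)
    (use assms in \<open>auto simp: lookup_add lookup_single lookup_squarefree_monom when_def\<close>)

lemma incidence_sign_square: "incidence_sign v T * incidence_sign v T = (1::'r::comm_ring_1)"
  unfolding incidence_sign_def by (simp flip: power_mult_distrib)

text \<open>Contracting homotopy in the multidegrees that are not square-free. A basis element \<open>T\<close> with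
  coefficient monomial \<open>t\<close> has multidegree \<open>t + squarefree_monom T\<close>. If \<open>a\<close> has exponent at
  least 2 there, moving \<open>a\<close> between \<open>T\<close> and the monomial does not change the support of the
  monomial after \<open>a\<close> has been added to it, so the homotopy respects the Stanley--Reisner ideal.\<close>

lemma nonsquarefree_part_is_boundary:
  fixes f :: "'v::{finite,linorder} set \<Rightarrow> ('v, 'k::field) mpoly"
  assumes f: "f \<in> koszul.graded_part i j"
    and cyc: "\<And>T t. Poly_Mapping.keys t \<in> \<Delta> \<Longrightarrow> koszul_coeff f T t = 0"
  obtains g where "g \<in> koszul.graded_part (Suc i) j"
    and "\<And>T t. Poly_Mapping.keys t \<in> \<Delta> \<Longrightarrow> koszul_coeff g T t =
      (if \<forall>v. Poly_Mapping.lookup (t + squarefree_monom T) v < 2 then 0 else Poly_Mapping.lookup (f T) t)"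
proof -
  define E where "E v = Poly_Mapping.single v (1::nat)" for v :: 'v
  define A where "A w = {v. 2 \<le> Poly_Mapping.lookup w v}" for w :: "'v \<Rightarrow>\<^sub>0 nat"
  \<comment> \<open>The vertex \<open>a\<close> depends only on the multidegree. It need not be the
    least element of \<open>T\<close>, unlike in \<open>koszul_homotopy\<close>, hence the explicit
    sign.\<close>
  define h where "h T t = (let a = Min (A (t + squarefree_monom T)) in
    if A (t + squarefree_monom T) \<noteq> {} \<and> a \<in> T
    then incidence_sign a (T - {a}) * Poly_Mapping.lookup (f (T - {a})) (t + E a) else 0)" for T t
  have "finite {t. h T t \<noteq> 0}" for T
  proof (rule finite_subset)
    show "{t. h T t \<noteq> 0} \<subseteq> (\<Union>m\<in>T. (\<lambda>s. s - E m) ` Poly_Mapping.keys (f (T - {m})))"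
      by (force simp: h_def Let_def in_keys_iff image_iff split: if_splits)
  qed (auto intro!: finite_UN_I)
  then have look: "Poly_Mapping.lookup (Poly_Mapping.Abs_poly_mapping (h T)) t = h T t" for T t by simp
  define g where "g T = Poly_Mapping.Abs_poly_mapping (h T)" for T
  note look = look[folded g_def]
  show thesis
  proof
    show "g \<in> koszul.graded_part (Suc i) j"
      unfolding graded_part_iff
    proof (intro allI impI)
      fix T t assume "Poly_Mapping.lookup (g T) t \<noteq> 0"
      then obtain a where a: "a \<in> T" "Poly_Mapping.lookup (f (T - {a})) (t + E a) \<noteq> 0"
        by (auto simp: look h_def Let_def split: if_splits)
      with f have "card (T - {a}) = i" "i + monom_deg (t + E a) = j"
        unfolding graded_part_iff by blast+
      with a(1) show "card T = Suc i \<and> Suc i + monom_deg t = j"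
        using card_Suc_Diff1[OF _ a(1)] by (simp add: monom_deg_add E_def monom_deg_single)
    qed
    fix T :: "'v set" and t :: "'v \<Rightarrow>\<^sub>0 nat" assume t: "Poly_Mapping.keys t \<in> \<Delta>"
    let ?w = "t + squarefree_monom T"
    show "koszul_coeff g T t = (if \<forall>v. Poly_Mapping.lookup ?w v < 2 then 0 else Poly_Mapping.lookup (f T) t)"
    proof (cases "A ?w = {}")
      case True
      then have "h (insert v T) (t - E v) = 0" if "Poly_Mapping.lookup t v \<noteq> 0" "v \<notin> T" for v
        using shift_monom_removed[OF that] by (simp add: h_def E_def)
      then have "koszul_coeff g T t = 0"
        unfolding koszul_coeff_def look E_def[symmetric] by (intro sum.neutral) auto
      moreover have "\<forall>v. Poly_Mapping.lookup ?w v < 2" using True by (auto simp: A_def not_le)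
      ultimately show ?thesis by simp
    next
      case False
      define a where "a = Min (A ?w)"
      have "a \<in> A ?w" unfolding a_def using False by (intro Min_in) auto
      then have wa: "2 \<le> Poly_Mapping.lookup ?w a" by (simp add: A_def)
      \<comment> \<open>\<open>T\<close> contributes at most 1 to the exponent of \<open>a\<close>,
        so \<open>a\<close> still divides \<open>t\<close>.\<close>
      then have ta: "Poly_Mapping.lookup t a \<noteq> 0" by (auto simp: lookup_add lookup_squarefree_monom split: if_splits)
      have sub: "koszul_coeff g T t = (\<Sum>v\<in>- T. incidence_sign v T *
          (if Poly_Mapping.lookup t v = 0 \<or> a \<notin> insert v T then 0
           else incidence_sign a (insert v T - {a}) * Poly_Mapping.lookup (f (insert v T - {a})) (t - E v + E a)))"
        unfolding koszul_coeff_def look E_def[symmetric]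
      proof (intro sum.cong refl)
        fix v assume "v \<in> - T"
        then show "incidence_sign v T * (if Poly_Mapping.lookup t v = 0 then 0 else h (insert v T) (t - E v)) =
          incidence_sign v T * (if Poly_Mapping.lookup t v = 0 \<or> a \<notin> insert v T then 0
           else incidence_sign a (insert v T - {a}) * Poly_Mapping.lookup (f (insert v T - {a})) (t - E v + E a))"
          using shift_monom_removed[of t v T] False
          by (cases "Poly_Mapping.lookup t v = 0") (simp_all add: h_def E_def Let_def a_def)
      qed
      have "koszul_coeff g T t = Poly_Mapping.lookup (f T) t"
      proof (cases "a \<in> T")
        case False
        have Ea: "t - E a + E a = t"
          using ta unfolding E_def by (rule minus_single_add)
        have "koszul_coeff g T t = (\<Sum>v\<in>- T. if v = a then Poly_Mapping.lookup (f T) t else 0)"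
          unfolding sub
        proof (intro sum.cong refl)
          fix v assume "v \<in> - T"
          show "incidence_sign v T * (if Poly_Mapping.lookup t v = 0 \<or> a \<notin> insert v T then 0
             else incidence_sign a (insert v T - {a}) * Poly_Mapping.lookup (f (insert v T - {a})) (t - E v + E a))
            = (if v = a then Poly_Mapping.lookup (f T) t else 0)"
            using False ta
            by (cases "v = a") (simp_all add: Ea incidence_sign_square flip: mult.assoc)
        qed
        then show ?thesis using False by simp
      next
        case True
        let ?c = "T - {a}"
        let ?G = "\<lambda>v. incidence_sign v ?c * (if Poly_Mapping.lookup (t + E a) v = 0 then 0
          else Poly_Mapping.lookup (f (insert v ?c)) (t + E a - E v))"
        have "Poly_Mapping.keys (t + E a) = Poly_Mapping.keys t"
          using ta
          by (auto simp: in_keys_iff lookup_add E_def lookup_single when_def split: if_splits)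
        \<comment> \<open>In this relation the summand for \<open>a\<close> is the wanted
          coefficient up to sign, and the others are, up to sign, the summands in
          \<open>sub\<close>.\<close>
        then have "koszul_coeff f ?c (t + E a) = 0" using cyc t by simp
        then have "(\<Sum>v\<in>- ?c. ?G v) = 0" unfolding koszul_coeff_def E_def .
        moreover have "- ?c = insert a (- T)" using True by auto
        ultimately have "?G a + (\<Sum>v\<in>- T. ?G v) = 0" using True by simp
        moreover have "?G a = incidence_sign a ?c * Poly_Mapping.lookup (f T) t"
          using True ta by (simp add: lookup_add E_def insert_absorb)
        ultimately have G: "(\<Sum>v\<in>- T. ?G v) = - (incidence_sign a ?c * Poly_Mapping.lookup (f T) t)"
          by (simp add: eq_neg_iff_add_eq_0 add.commute)
        have "koszul_coeff g T t = (\<Sum>v\<in>- T. - incidence_sign a ?c * ?G v)"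
          unfolding sub
        proof (intro sum.cong refl)
          fix v assume "v \<in> - T"
          then have va: "v \<noteq> a" and vT: "v \<notin> T" using True by auto
          have ins: "insert v T - {a} = insert v ?c" using va by auto
          have "Poly_Mapping.lookup (t + E a) v = Poly_Mapping.lookup t v"
            using va by (simp add: lookup_add E_def lookup_single when_def)
          moreover have "t - E v + E a = t + E a - E v" if "Poly_Mapping.lookup t v \<noteq> 0"
            by (rule poly_mapping_eqI)
              (use va that in \<open>auto simp: lookup_add lookup_minus lookup_single when_def E_def\<close>)
          moreover have "incidence_sign v T * incidence_sign a (insert v ?c)
              = - incidence_sign a ?c * (incidence_sign v ?c :: 'k)"
          proof -
            have "incidence_sign v ?c * incidence_sign a (insert v ?c)
                = - (incidence_sign a ?c * (incidence_sign v T :: 'k))"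
              using incidence_sign_anticommute[of a v ?c, where 'r='k] va vT True
              by (simp add: insert_absorb)
            \<comment> \<open>Multiplying by two signs, each of square 1, moves them to the other
              side of the anticommutation rule.\<close>
            then have "incidence_sign v T * incidence_sign v ?c *
                (incidence_sign v ?c * incidence_sign a (insert v ?c))
                = incidence_sign v T * incidence_sign v ?c *
                  - (incidence_sign a ?c * (incidence_sign v T :: 'k))" by simp
            moreover have "incidence_sign v T * incidence_sign v ?c *
                (incidence_sign v ?c * incidence_sign a (insert v ?c))
                = incidence_sign v T * (incidence_sign v ?c * incidence_sign v ?c) *
                  (incidence_sign a (insert v ?c) :: 'k)" by (simp only: mult_ac)
            moreover have "incidence_sign v T * incidence_sign v ?c *
                  - (incidence_sign a ?c * (incidence_sign v T :: 'k))
                = - incidence_sign a ?c * incidence_sign v ?c *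
                  (incidence_sign v T * incidence_sign v T)" by (simp add: mult_ac)
            ultimately show ?thesis by (simp only: incidence_sign_square mult_1_right)
          qed
          ultimately show "incidence_sign v T * (if Poly_Mapping.lookup t v = 0 \<or> a \<notin> insert v T then 0
             else incidence_sign a (insert v T - {a}) * Poly_Mapping.lookup (f (insert v T - {a})) (t - E v + E a))
            = - incidence_sign a ?c * ?G v"
            using True unfolding ins by (cases "Poly_Mapping.lookup t v = 0") (simp_all flip: mult.assoc)
        qed
        also have "\<dots> = - incidence_sign a ?c * (\<Sum>v\<in>- T. ?G v)"
          by (simp only: sum_distrib_left)
        also have "\<dots> = Poly_Mapping.lookup (f T) t"
          unfolding G by (simp add: incidence_sign_square flip: mult.assoc)
        finally show ?thesis .
      qed
      moreover have "\<not> (\<forall>v. Poly_Mapping.lookup ?w v < 2)" using wa by (auto simp: not_less)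
      ultimately show ?thesis by (simp only: if_False)
    qed
  qed
qed

text \<open>A cycle splits by multidegree, and its part outside the square-free multidegrees always
  bounds. The premise speaks of all square-free chains, so the square-free part \<open>p\<close>
  need not be shown to be a cycle.\<close>

lemma betti_eq_0I_squarefree:
  fixes \<Delta> :: "'v::{finite,linorder} set set"
  assumes \<Delta>: "simplicial_complex \<Delta>"
    and sqf: "\<And>f :: 'v set \<Rightarrow> ('v, 'k::field) mpoly. f \<in> koszul.graded_part i j \<Longrightarrow>
      (\<And>T t v. Poly_Mapping.lookup (f T) t \<noteq> 0 \<Longrightarrow> Poly_Mapping.lookup (t + squarefree_monom T) v < 2) \<Longrightarrow>
      f \<in> koszul.boundaries (stanley_reisner_ideal \<Delta>) i j"
  shows "betti (stanley_reisner_ideal \<Delta> :: ('v, 'k) mpoly set) i j = 0"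
  unfolding betti_eq_0_iff[OF \<Delta>]
proof
  fix f :: "'v set \<Rightarrow> ('v, 'k) mpoly"
  assume "f \<in> koszul.cycles (stanley_reisner_ideal \<Delta>) i j"
  then have f: "f \<in> koszul.graded_part i j"
    and cyc: "\<And>T t. Poly_Mapping.keys t \<in> \<Delta> \<Longrightarrow> koszul_coeff f T t = 0"
    unfolding cycles_iff[OF \<Delta>] by auto
  let ?s = "\<lambda>T t. \<forall>v. Poly_Mapping.lookup (t + squarefree_monom T) v < 2"
  define p where "p T = Poly_Mapping.Abs_poly_mapping (\<lambda>t. if ?s T t then Poly_Mapping.lookup (f T) t else 0)" for T
  have "finite {t. (if ?s T t then Poly_Mapping.lookup (f T) t else 0) \<noteq> 0}" for T
    by (rule finite_subset[OF _ finite_keys[of "f T"]]) (auto simp: in_keys_iff)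
  then have p: "Poly_Mapping.lookup (p T) t = (if ?s T t then Poly_Mapping.lookup (f T) t else 0)" for T t
    by (simp add: p_def)
  have pg: "p \<in> koszul.graded_part i j"
    using f unfolding graded_part_iff p by auto
  have "p \<in> koszul.boundaries (stanley_reisner_ideal \<Delta>) i j"
    by (rule sqf[OF pg]) (auto simp: p split: if_splits)
  then obtain g1 where g1: "g1 \<in> koszul.graded_part (Suc i) j"
    "\<And>T t. Poly_Mapping.keys t \<in> \<Delta> \<Longrightarrow> Poly_Mapping.lookup (p T) t = koszul_coeff g1 T t"
    unfolding boundaries_iff[OF \<Delta>] by blast
  obtain g2 where g2: "g2 \<in> koszul.graded_part (Suc i) j"
    "\<And>T t. Poly_Mapping.keys t \<in> \<Delta> \<Longrightarrow> koszul_coeff g2 T t = (if ?s T t then 0 else Poly_Mapping.lookup (f T) t)"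
    using nonsquarefree_part_is_boundary[OF f cyc] by blast
  have "Poly_Mapping.lookup (f T) t = koszul_coeff (g1 + g2) T t" if "Poly_Mapping.keys t \<in> \<Delta>" for T t
    using that g1(2)[OF that, of T] g2(2)[OF that, of T]
    by (cases "?s T t") (simp_all only: koszul_coeff_add p simp_thms if_True if_False add_0_left add_0_right)
  then show "f \<in> koszul.boundaries (stanley_reisner_ideal \<Delta>) i j"
    unfolding boundaries_iff[OF \<Delta>] using f graded_part_add[OF g1(1) g2(1)] by blast
qed

section \<open>Vanishing and non-vanishing of individual Betti numbers\<close>

text \<open>A square-free monomial of degree \<open>j - i > d\<close> has more than \<open>d\<close>
  vertices in its support, so a square-free chain is zero modulo the ideal and is bounded by
  0.\<close>

lemma betti_eq_0_above_dim:
  fixes \<Delta> :: "'v::{finite,linorder} set set"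
  assumes \<Delta>: "simplicial_complex \<Delta>" and le: "\<And>F. F \<in> \<Delta> \<Longrightarrow> card F \<le> d" and "i + d < j"
  shows "betti (stanley_reisner_ideal \<Delta> :: ('v, 'k::field) mpoly set) i j = 0"
proof (rule betti_eq_0I_squarefree[OF \<Delta>])
  fix f :: "'v set \<Rightarrow> ('v, 'k) mpoly"
  assume f: "f \<in> koszul.graded_part i j"
    and s: "\<And>T t v. Poly_Mapping.lookup (f T) t \<noteq> 0 \<Longrightarrow> Poly_Mapping.lookup (t + squarefree_monom T) v < 2"
  have "Poly_Mapping.lookup (f T) t = 0" if "Poly_Mapping.keys t \<in> \<Delta>" for T t
  proof (rule ccontr)
    assume nz: "Poly_Mapping.lookup (f T) t \<noteq> 0"
    have "Poly_Mapping.lookup t v < 2" for v using s[OF nz, of v] by (simp add: lookup_add)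
    then have "card (Poly_Mapping.keys t) = monom_deg t" by (rule card_keys_eq_monom_deg)
    moreover have "i + monom_deg t = j" using f nz unfolding graded_part_iff by blast
    ultimately show False using le[OF that] \<open>i + d < j\<close> by simp
  qed
  moreover have "0 \<in> (koszul.graded_part (Suc i) j :: ('v set \<Rightarrow> ('v, 'k) mpoly) set)"
    unfolding graded_part_iff by simp
  ultimately show "f \<in> koszul.boundaries (stanley_reisner_ideal \<Delta>) i j"
    unfolding boundaries_iff[OF \<Delta>] using f by (auto intro!: bexI[of _ 0] simp: koszul_coeff_zero)
qed

text \<open>In degree \<open>j = i + d\<close> every square-free chain is a cycle, because its differential involves
  only square-free monomials of degree \<open>d + 1\<close>, which exceeds the size of all faces. So the
  vanishing for \<open>\<Delta>p\<close> already provides all the boundaries needed for \<open>\<Delta>\<close>.\<close>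

lemma betti_eq_0_subcomplex:
  fixes \<Delta> \<Delta>p :: "'v::{finite,linorder} set set"
  assumes \<Delta>: "simplicial_complex \<Delta>" and \<Delta>p: "simplicial_complex \<Delta>p" and "\<Delta> \<subseteq> \<Delta>p"
    and le: "\<And>F. F \<in> \<Delta>p \<Longrightarrow> card F \<le> d"
    and van: "betti (stanley_reisner_ideal \<Delta>p :: ('v, 'k::field) mpoly set) i (i + d) = 0"
  shows "betti (stanley_reisner_ideal \<Delta> :: ('v, 'k) mpoly set) i (i + d) = 0"
proof (rule betti_eq_0I_squarefree[OF \<Delta>])
  fix f :: "'v set \<Rightarrow> ('v, 'k) mpoly"
  assume f: "f \<in> koszul.graded_part i (i + d)"
    and s: "\<And>T t v. Poly_Mapping.lookup (f T) t \<noteq> 0 \<Longrightarrow> Poly_Mapping.lookup (t + squarefree_monom T) v < 2"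
  have "koszul_coeff f T t = 0" if t: "Poly_Mapping.keys t \<in> \<Delta>p" for T t
    unfolding koszul_coeff_def
  proof (intro sum.neutral ballI, rule ccontr)
    fix v assume "v \<in> - T"
      and "incidence_sign v T * (if Poly_Mapping.lookup t v = 0 then 0
        else Poly_Mapping.lookup (f (insert v T)) (t - Poly_Mapping.single v 1)) \<noteq> 0"
    then have v: "v \<notin> T" "Poly_Mapping.lookup t v \<noteq> 0"
      and nz: "Poly_Mapping.lookup (f (insert v T)) (t - Poly_Mapping.single v 1) \<noteq> 0"
      by (auto split: if_splits)
    have "Poly_Mapping.lookup (t + squarefree_monom T) u < 2" for u
      using s[OF nz, of u] unfolding shift_monom_removed[OF v(2,1)] .
    then have "Poly_Mapping.lookup t u < 2" for u by (metis lookup_add add_lessD1)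
    then have "card (Poly_Mapping.keys t) = monom_deg t" by (rule card_keys_eq_monom_deg)
    moreover have "t - Poly_Mapping.single v 1 + Poly_Mapping.single v 1 = t"
        using v(2) by (rule minus_single_add)
    then have "monom_deg t = monom_deg (t - Poly_Mapping.single v 1) + 1"
      by (metis monom_deg_add monom_deg_single)
    moreover have "i + monom_deg (t - Poly_Mapping.single v 1) = i + d"
      using f nz unfolding graded_part_iff by blast
    ultimately show False using le[OF t] by simp
  qed
  then have "f \<in> koszul.cycles (stanley_reisner_ideal \<Delta>p) i (i + d)"
    unfolding cycles_iff[OF \<Delta>p] using f by blast
  then have "f \<in> koszul.boundaries (stanley_reisner_ideal \<Delta>p) i (i + d)"
    using van unfolding betti_eq_0_iff[OF \<Delta>p] by blast
  then show "f \<in> koszul.boundaries (stanley_reisner_ideal \<Delta>) i (i + d)"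
    unfolding boundaries_iff[OF \<Delta>p] boundaries_iff[OF \<Delta>] using \<open>\<Delta> \<subseteq> \<Delta>p\<close> by blast
qed

lemma betti_eq_0_above_card:
  fixes \<Delta> :: "'v::{finite,linorder} set set"
  assumes \<Delta>: "simplicial_complex \<Delta>" and "card (UNIV :: 'v set) < i"
  shows "betti (stanley_reisner_ideal \<Delta> :: ('v, 'k::field) mpoly set) i j = 0"
  unfolding betti_eq_0_iff[OF \<Delta>]
proof
  fix f :: "'v set \<Rightarrow> ('v, 'k) mpoly"
  assume "f \<in> koszul.cycles (stanley_reisner_ideal \<Delta>) i j"
  then have f: "f \<in> koszul.graded_part i j" by (simp add: koszul.cycles_def)
  have "card T \<noteq> i" for T :: "'v set"
    using card_mono[of UNIV T] \<open>card (UNIV :: 'v set) < i\<close> by auto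
  then have "Poly_Mapping.lookup (f T) t = 0" for T t
    using f unfolding graded_part_iff by blast
  moreover have "0 \<in> (koszul.graded_part (Suc i) j :: ('v set \<Rightarrow> ('v, 'k) mpoly) set)"
    unfolding graded_part_iff by simp
  ultimately show "f \<in> koszul.boundaries (stanley_reisner_ideal \<Delta>) i j"
    unfolding boundaries_iff[OF \<Delta>] using f by (auto intro!: bexI[of _ 0] simp: koszul_coeff_zero)
qed

text \<open>The minimal generator of \<open>F\<close> gives the Koszul chain with coefficient the
  monomial of \<open>F - {a}\<close> at \<open>{a}\<close>. Its differential is the monomial of
  \<open>F\<close>, which lies in the ideal but is not zero.\<close>

lemma betti_1_nonzero:
  fixes \<Delta> :: "'v::{finite,linorder} set set"
  assumes \<Delta>: "simplicial_complex \<Delta>" and skel: "\<And>F. card F < d \<Longrightarrow> F \<in> \<Delta>"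
    and F: "card F = d" "F \<notin> \<Delta>"
  shows "betti (stanley_reisner_ideal \<Delta> :: ('v, 'k::field) mpoly set) 1 d \<noteq> 0"
proof -
  have "F \<noteq> {}" using F(2) empty_in_simplicial_complex[OF \<Delta>] by blast
  then obtain a where a: "a \<in> F" by blast
  define f :: "'v set \<Rightarrow> ('v, 'k) mpoly"
    where "f T = (if T = {a} then Poly_Mapping.single (squarefree_monom (F - {a})) 1 else 0)" for T
  have nz: "T = {a} \<and> t = squarefree_monom (F - {a})" if "Poly_Mapping.lookup (f T) t \<noteq> 0" for T t
    using that by (auto simp: f_def lookup_single when_def split: if_splits)
  have d: "1 + card (F - {a}) = d" using F(1) a by (metis card_Suc_Diff1 finite plus_1_eq_Suc)
  have f: "f \<in> koszul.graded_part 1 d"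
    unfolding graded_part_iff using nz d by fastforce
  have shift: "squarefree_monom F = squarefree_monom (F - {a}) + Poly_Mapping.single a 1"
    by (rule poly_mapping_eqI)
      (use a in \<open>auto simp: lookup_add lookup_single lookup_squarefree_monom when_def\<close>)
  have coeff: "T = {} \<and> t = squarefree_monom F" if "koszul_coeff f T t \<noteq> 0" for T t
  proof -
    obtain v where "v \<in> - T" and "incidence_sign v T * (if Poly_Mapping.lookup t v = 0 then 0
        else Poly_Mapping.lookup (f (insert v T)) (t - Poly_Mapping.single v 1)) \<noteq> 0"
      using \<open>koszul_coeff f T t \<noteq> 0\<close> unfolding koszul_coeff_def
      by (rule sum.not_neutral_contains_not_neutral)
    then have v: "v \<in> - T" "Poly_Mapping.lookup t v \<noteq> 0"
        "Poly_Mapping.lookup (f (insert v T)) (t - Poly_Mapping.single v 1) \<noteq> 0"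
      by (auto split: if_splits)
    then have va: "insert v T = {a}" "t - Poly_Mapping.single v 1 = squarefree_monom (F - {a})"
      using nz by blast+
    moreover have "t - Poly_Mapping.single v 1 + Poly_Mapping.single v 1 = t"
        using v(2) by (rule minus_single_add)
    ultimately show ?thesis using v(1) shift by auto
  qed
  then have "f \<in> koszul.cycles (stanley_reisner_ideal \<Delta>) 1 d"
    unfolding cycles_iff[OF \<Delta>] using f F(2) by (metis keys_squarefree_monom)
  moreover have "f \<notin> koszul.boundaries (stanley_reisner_ideal \<Delta>) 1 d"
  proof
    assume "f \<in> koszul.boundaries (stanley_reisner_ideal \<Delta>) 1 d"
    then obtain g where g: "g \<in> koszul.graded_part (Suc 1) d"
      and fg: "\<And>T t. Poly_Mapping.keys t \<in> \<Delta> \<Longrightarrow> Poly_Mapping.lookup (f T) t = koszul_coeff g T t"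
      unfolding boundaries_iff[OF \<Delta>] by blast
    \<comment> \<open>The congruence modulo the ideal is an honest equality: below degree
      \<open>d\<close> the ideal has no monomials, and from degree \<open>d\<close> on both sides
      vanish by grading. Then the differential of \<open>f\<close> would be zero.\<close>
    have "Poly_Mapping.lookup (f T) t = koszul_coeff g T t" for T t
    proof (cases "monom_deg t < d")
      case True
      then have "Poly_Mapping.keys t \<in> \<Delta>" using card_keys_le_monom_deg[of t] by (intro skel) simp
      then show ?thesis by (rule fg)
    next
      case False
      have "Poly_Mapping.lookup (f T) t = 0"
        using f False unfolding graded_part_iff by (metis less_add_one add.commute)
      moreover have "koszul_coeff g T t = 0"
        unfolding koszul_coeff_def
      proof (intro sum.neutral ballI, rule ccontr)
        fix v assume "incidence_sign v T * (if Poly_Mapping.lookup t v = 0 then 0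
            else Poly_Mapping.lookup (g (insert v T)) (t - Poly_Mapping.single v 1)) \<noteq> 0"
        then have v: "Poly_Mapping.lookup t v \<noteq> 0" "Poly_Mapping.lookup (g (insert v T)) (t - Poly_Mapping.single v 1) \<noteq> 0"
          by (auto split: if_splits)
        have "t - Poly_Mapping.single v 1 + Poly_Mapping.single v 1 = t"
        using v(1) by (rule minus_single_add)
        then have "monom_deg t = monom_deg (t - Poly_Mapping.single v 1) + 1"
          by (metis monom_deg_add monom_deg_single)
        moreover have "Suc 1 + monom_deg (t - Poly_Mapping.single v 1) = d"
          using g v(2) unfolding graded_part_iff by blast
        ultimately show False using False by simp
      qed
      ultimately show ?thesis by simp
    qed
    then have fd: "f = differential koszul_basis koszul_matrix 1 g"
      using lookup_koszul_differential[OF graded_part_free[OF g]]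
      by (intro ext poly_mapping_eqI) simp
    have "koszul_coeff f {} (squarefree_monom F)
        = Poly_Mapping.lookup (differential koszul_basis koszul_matrix 0 f {}) (squarefree_monom F)"
      using graded_part_free[OF f] by (simp add: lookup_koszul_differential)
    also have "\<dots> = 0"
      using koszul_differential_differential[of g 0] graded_part_free[OF g] by (simp add: fd)
    finally have "koszul_coeff f {} (squarefree_monom F) = 0" .
    moreover have "koszul_coeff f {} (squarefree_monom F) = (\<Sum>v\<in>UNIV. if v = a then 1 else 0)"
      unfolding koszul_coeff_def
    proof (intro sum.cong)
      fix v
      show "incidence_sign v {} * (if Poly_Mapping.lookup (squarefree_monom F) v = 0 then 0
          else Poly_Mapping.lookup (f (insert v {})) (squarefree_monom F - Poly_Mapping.single v 1))
        = (if v = a then 1 else 0)"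
        using a by (auto simp: f_def shift lookup_add incidence_sign_def)
    qed auto
    ultimately show False by simp
  qed
  ultimately show ?thesis unfolding betti_eq_0_iff[OF \<Delta>] by blast
qed

section \<open>Regularity and the final assembly\<close>

text \<open>Regularity is a \<open>Max\<close>, which is informative only on a finite set; the
  bounds \<open>i \<le> n\<close>, for \<open>n\<close> vertices, and \<open>j \<le> i + d\<close>
  confine the differences.\<close>

lemma finite_betti_degrees:
  fixes \<Delta> :: "'v::{finite,linorder} set set"
  assumes \<Delta>: "simplicial_complex \<Delta>" and le: "\<And>F. F \<in> \<Delta> \<Longrightarrow> card F \<le> d"
  shows "finite {int j - int i | i j. betti (stanley_reisner_ideal \<Delta> :: ('v, 'k::field) mpoly set) i j \<noteq> 0}"
proof (rule finite_subset)
  show "{int j - int i | i j. betti (stanley_reisner_ideal \<Delta> :: ('v, 'k) mpoly set) i j \<noteq> 0}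
      \<subseteq> {- int (card (UNIV :: 'v set))..int d}"
  proof
    fix x
    assume "x \<in> {int j - int i | i j. betti (stanley_reisner_ideal \<Delta> :: ('v, 'k) mpoly set) i j \<noteq> 0}"
    then obtain i j where x: "x = int j - int i"
      and nz: "betti (stanley_reisner_ideal \<Delta> :: ('v, 'k) mpoly set) i j \<noteq> 0" by blast
    have "i \<le> card (UNIV :: 'v set)" "j \<le> i + d"
      using nz betti_eq_0_above_card[OF \<Delta>] betti_eq_0_above_dim[OF \<Delta> le] by (meson not_le)+
    then show "x \<in> {- int (card (UNIV :: 'v set))..int d}" by (simp add: x)
  qed
qed simp

lemma has_linear_resolution_subcomplex:
  fixes \<Delta>m \<Delta> \<Delta>p :: "'v::{finite,linorder} set set"
  assumes \<Delta>: "simplicial_complex \<Delta>" and \<Delta>p: "simplicial_complex \<Delta>p" and sub: "\<Delta> \<subseteq> \<Delta>p"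
    and le: "\<And>F. F \<in> \<Delta>p \<Longrightarrow> card F \<le> d"
    and skel: "\<And>F. card F < d \<Longrightarrow> F \<in> \<Delta>"
    and lin: "has_linear_resolution d (stanley_reisner_ideal \<Delta>p :: ('v, 'k::field) mpoly set)"
  shows "has_linear_resolution d (stanley_reisner_ideal \<Delta> :: ('v, 'k) mpoly set)"
proof -
  let ?I = "\<lambda>\<Delta>. stanley_reisner_ideal \<Delta> :: ('v, 'k) mpoly set"
  let ?R = "\<lambda>\<Delta>. {int j - int i | i j. betti (?I \<Delta>) i j \<noteq> 0}"
  have le': "\<And>F. F \<in> \<Delta> \<Longrightarrow> card F \<le> d" using le sub by blast
  have indeg_p: "indeg (?I \<Delta>p) = enat d" and reg_p: "Max (?R \<Delta>p) = int d - 1"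
    using lin by (auto simp: has_linear_resolution_def regularity_def)
  \<comment> \<open>A smallest non-face of \<open>\<Delta>p\<close> is also a non-face of
    \<open>\<Delta>\<close>; it fixes the initial degree and, through the first Betti number, the
    lower bound on the regularity.\<close>
  obtain F where F: "card F = d" "F \<notin> \<Delta>"
    using indeg_p sub unfolding indeg_stanley_reisner_ideal[OF \<Delta>p] by blast
  have van_p: "betti (?I \<Delta>p) i (i + d) = 0" for i
  proof (rule ccontr)
    assume "betti (?I \<Delta>p) i (i + d) \<noteq> 0"
    then have "int (i + d) - int i \<le> Max (?R \<Delta>p)"
      by (intro Max_ge finite_betti_degrees[OF \<Delta>p le]) blast+
    with reg_p show False by simp
  qed
  have "int j - int i \<le> int d - 1" if nz: "betti (?I \<Delta>) i j \<noteq> 0" for i j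
  proof -
    have "j \<le> i + d" using nz betti_eq_0_above_dim[OF \<Delta> le'] by (meson not_le)
    moreover have "betti (?I \<Delta>) i (i + d) = 0"
      by (rule betti_eq_0_subcomplex[OF \<Delta> \<Delta>p sub le van_p])
    with nz have "j \<noteq> i + d" by blast
    ultimately show ?thesis by simp
  qed
  moreover have "int d - int 1 \<in> ?R \<Delta>"
    using betti_1_nonzero[OF \<Delta> skel F] by blast
  ultimately have "Max (?R \<Delta>) = int d - 1"
    by (intro Max_eqI finite_betti_degrees[OF \<Delta> le']) auto
  moreover have "indeg (?I \<Delta>) = enat d"
    unfolding indeg_stanley_reisner_ideal[OF \<Delta>] using skel F by blast
  ultimately show ?thesis by (simp add: has_linear_resolution_def regularity_def)
qed

theorem theorem5p7:
  fixes d :: nat and \<Delta>m \<Delta> \<Delta>p :: "'v::{finite,linorder} set set"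
  assumes "2 \<le> d"
    and "simplicial_complex \<Delta>m" and "simplicial_complex \<Delta>" and "simplicial_complex \<Delta>p"
    and "\<Delta>m \<subseteq> \<Delta>" and "\<Delta> \<subseteq> \<Delta>p"
    and "complex_dim \<Delta>m = int d - 1" and "complex_dim \<Delta>p = int d - 1"
    and "buchsbaum TYPE('k::field) \<Delta>m" and "buchsbaum TYPE('k) \<Delta>p"
    and "has_linear_resolution d (stanley_reisner_ideal \<Delta>m :: ('v, 'k) mpoly set)"
    and "has_linear_resolution d (stanley_reisner_ideal \<Delta>p :: ('v, 'k) mpoly set)"
  shows "buchsbaum TYPE('k) \<Delta> \<and>
    has_linear_resolution d (stanley_reisner_ideal \<Delta> :: ('v, 'k) mpoly set)"
proof
  have le: "card F \<le> d" if "F \<in> \<Delta>p" for F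
    using card_le_of_complex_dim assms(8) that .
  \<comment> \<open>Initial degree \<open>d\<close> leaves no non-face with fewer than
    \<open>d\<close> vertices.\<close>
  have skel: "F \<in> \<Delta>m" if "card F < d" for F
    using assms(11) that
    unfolding has_linear_resolution_def indeg_stanley_reisner_ideal[OF assms(2)] by blast
  show "buchsbaum TYPE('k) \<Delta>"
    using assms(2,3,5,7) _ skel assms(9) by (rule buchsbaum_between) (use le assms(6) in blast)
  have "F \<in> \<Delta>" if "card F < d" for F
    using skel[OF that] assms(5) by blast
  with assms(3,4,6) le
  show "has_linear_resolution d (stanley_reisner_ideal \<Delta> :: ('v, 'k) mpoly set)"
    using assms(12) by (rule has_linear_resolution_subcomplex)
qed

end
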